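(* Let $K$ be a finite simplicial complex and let $f:|K|\to|K|$ be a continuous map. Then $f$ has a fixed point if and only if there exist a finite approximative sequence $(X^n,h_{n,n+1})$ for $f$ (with associated multivalued maps $F_{n+1}:X^{n+1}\multimap X^{n+1}$), a sequence $\{x_{n+1}\}_{n\in\mathbb{N}}$ and $m\in\mathbb{N}$ such that $x_{n+1}\in X^{n+1}$ and $x_n=h_{n,n+1}(x_{n+1})$ for every $n\in\mathbb{N}$, and $x_{n+1}\in F_{n+1}(x_{n+1})$ for every $n+1\geq m$.
   Context: Here $\mathbb{N}=\{0,1,2,\dots\}$, and $x_0\in X^0$ is just $h_{0,1}(x_1)$. $|K|$ is the geometric realization of $K$, and $K^n$ is the $n$-th iterated barycentric subdivision of $K$ ($K^0=K$, $|K^n|=|K|$). Two maps $u,v:|M|\to|L|$ between realizations of simplicial complexes are simplicially close if for every point $x$ there is a simplex of $L$ containing both $u(x)$ and $v(x)$ in its closure. Finite $T_0$ spaces are identified with finite posets. The face poset $\mathcal{X}(K)$ is the set of simplices of $K$ ordered by inclusion; here it is considered with the opposite order (opposite topology). The finite barycentric subdivision $X'$ of a finite poset $X$ is the poset of non-empty chains of $X$, ordered by inclusion, and the natural map $h:X'\to X$ sends a chain $x_1<\dots<x_r$ to its maximum $x_r$. Let $X^0=\mathcal{X}(K)$ (with the opposite order) and let $X^n$ be its $n$-th finite barycentric subdivision, so that the points of $X^n$ are the simplices of $K^n$. Let $h_{n,n+1}:X^{n+1}\to X^n$ be the natural map and, for $n\leq l$, let $h_{n,l}:X^l\to X^n$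 be the composition of these maps ($h_{n,n}$ is the identity). Finite approximative sequence for $f$. By the simplicial approximation theorem one obtains an increasing map $\varphi:\mathbb{N}\to\mathbb{N}$ and, for every $n$, a simplicial map $f_n:K^{\varphi(n)}\to K^n$ simplicially close to $f$; it induces a map $X^{\varphi(n)}\to X^n$, $\sigma\mapsto f_n(\sigma)$, also denoted $f_n$. Put $k_0=0$ and $k_{n+1}=\varphi(k_n)$, where $k_0<k_1<k_2<\cdots$. Relabel $X^{k_n}$ as $X^n$, the map $h_{k_n,k_{n+1}}$ as $h_{n,n+1}:X^{n+1}\to X^n$, and the map $f_{k_n}:X^{k_{n+1}}\to X^{k_n}$ as $f_{n,n+1}:X^{n+1}\to X^n$. An inverse sequence $(X^n,h_{n,n+1})$ obtained from $|K|$ in this way, together with the maps $f_{n,n+1}$, is called a finite approximative sequence for $f$. The associated multivalued maps $F_{n+1}:X^{n+1}\multimap X^{n+1}$ are given by $F_{n+1}(x)=h_{n,n+1}^{-1}(f_{n,n+1}(x))$. *)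

theory Defs
  imports "HOL-Analysis.Analysis"
begin

text \<open>
  A finite simplicial complex \<open>K\<close> is rendered by the library predicate
  \<^const>\<open>simplicial_complex\<close>: a finite family of closed geometric simplices in a Euclidean
  space of arbitrary dimension.  Its realization \<open>|K|\<close> is \<open>\<Union>K\<close> with the subspace
  topology.  The library allows the empty set as a simplex (of dimension \<open>-1\<close>);
  \<open>simplices\<close> discards it.
\<close>

definition simplices :: "'a::euclidean_space set set \<Rightarrow> 'a set set" where
  "simplices K = K - {{}}"

definition verts :: "'a::euclidean_space set \<Rightarrow> 'a set" where
  "verts S = {v. v extreme_point_of S}"

definition barycenter :: "'a::euclidean_space set \<Rightarrow> 'a" where
  "barycenter S = (\<Sum>v\<in>verts S. v) /\<^sub>R real (card (verts S))"

text \<open>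
  Finite posets are represented by their order relations \<open>r\<close>; the set of points of the
  poset is \<^term>\<open>Field r\<close>.
\<close>

definition face_poset :: "'a::euclidean_space set set \<Rightarrow> 'a set rel" where
  "face_poset K = {(S, T). S \<in> simplices K \<and> T \<in> simplices K \<and> S \<subseteq> T}"

definition finite_subdivision :: "'p rel \<Rightarrow> 'p set rel" where
  "finite_subdivision r =
     {(C, D). C \<in> Chains r - {{}} \<and> D \<in> Chains r - {{}} \<and> C \<subseteq> D}"

definition chain_max :: "'p rel \<Rightarrow> 'p set \<Rightarrow> 'p" where
  "chain_max r C = (THE m. m \<in> C \<and> (\<forall>c\<in>C. (c, m) \<in> r))"

text \<open>
  The simplex of the barycentric subdivision spanned by a chain of simplices.  It is what
  identifies the points of a finite barycentric subdivision with simplices.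
\<close>

definition chain_simplex :: "'a::euclidean_space set set \<Rightarrow> 'a set" where
  "chain_simplex C = convex hull (barycenter ` C)"

text \<open>The empty chain contributes the empty simplex.\<close>

definition bary_subdivision :: "'a::euclidean_space set set \<Rightarrow> 'a set set" where
  "bary_subdivision K = chain_simplex ` Chains (face_poset K)"

definition iter_subdivision :: "'a::euclidean_space set set \<Rightarrow> nat \<Rightarrow> 'a set set" where
  "iter_subdivision K n = (bary_subdivision ^^ n) K"

text \<open>
  The posets \<open>X\<^sup>n\<close>: \<open>X\<^sup>0\<close> is the face poset with the opposite order, and
  \<open>X\<^sup>n\<^sup>+\<^sup>1\<close> is the finite barycentric subdivision of \<open>X\<^sup>n\<close> (chains ordered by
  inclusion), carried over along \<^const>\<open>chain_simplex\<close> so that its points are simplices of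
  the next barycentric subdivision of \<open>K\<close>.
\<close>

primrec fin_space :: "'a::euclidean_space set set \<Rightarrow> nat \<Rightarrow> 'a set rel" where
  "fin_space K 0 = (face_poset K)\<inverse>"
| "fin_space K (Suc n) =
     map_prod chain_simplex chain_simplex ` finite_subdivision (fin_space K n)"

text \<open>
  The natural map \<open>h\<^sub>n\<^sub>,\<^sub>n\<^sub>+\<^sub>1\<close>: recover the chain of \<open>X\<^sup>n\<close> that spans the given simplex
  and take its maximum.
\<close>

definition natural_step :: "'a::euclidean_space set set \<Rightarrow> nat \<Rightarrow> 'a set \<Rightarrow> 'a set" where
  "natural_step K n S =
     chain_max (fin_space K n)
       (the_inv_into (Chains (fin_space K n) - {{}}) chain_simplex S)"

primrec natural_steps :: "'a::euclidean_space set set \<Rightarrow> nat \<Rightarrow> nat \<Rightarrow> 'a set \<Rightarrow> 'a set" where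
  "natural_steps K n 0 = id"
| "natural_steps K n (Suc d) = natural_steps K n d \<circ> natural_step K (n + d)"

text \<open>The map \<open>h\<^sub>n\<^sub>,\<^sub>l : X\<^sup>l \<rightarrow> X\<^sup>n\<close>, for \<open>n \<le> l\<close>.\<close>

definition natural_map :: "'a::euclidean_space set set \<Rightarrow> nat \<Rightarrow> nat \<Rightarrow> 'a set \<Rightarrow> 'a set" where
  "natural_map K n l = natural_steps K n (l - n)"

text \<open>
  A simplicial map \<open>M \<rightarrow> L\<close> is given by its realization \<open>|M| \<rightarrow> |L|\<close>: it maps the
  vertices of each simplex of \<open>M\<close> onto the vertices of a simplex of \<open>L\<close> and is affine on each
  simplex.  The induced map on simplices is therefore the image map.
\<close>

definition simplicial_map ::
    "'a::euclidean_space set set \<Rightarrow> 'a set set \<Rightarrow> ('a \<Rightarrow> 'a) \<Rightarrow> bool" where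
  "simplicial_map M L u \<longleftrightarrow>
     (\<forall>S\<in>simplices M.
        (\<exists>T\<in>simplices L. u ` verts S = verts T) \<and>
        (\<forall>x\<in>S. \<forall>y\<in>S. \<forall>t\<in>{0..1}.
           u ((1 - t) *\<^sub>R x + t *\<^sub>R y) = (1 - t) *\<^sub>R u x + t *\<^sub>R u y))"

definition simplicially_close ::
    "'a::euclidean_space set set \<Rightarrow> 'a set set \<Rightarrow> ('a \<Rightarrow> 'a) \<Rightarrow> ('a \<Rightarrow> 'a) \<Rightarrow> bool" where
  "simplicially_close M L u v \<longleftrightarrow> (\<forall>x\<in>\<Union>M. \<exists>S\<in>simplices L. u x \<in> S \<and> v x \<in> S)"

text \<open>
  \<open>X\<close>, \<open>h\<close>, \<open>ff\<close> are the relabelled data: \<open>X n\<close> is \<open>X\<^sup>n\<close>, \<open>h n\<close> is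
  \<open>h\<^sub>n\<^sub>,\<^sub>n\<^sub>+\<^sub>1\<close> and \<open>ff n\<close> is \<open>f\<^sub>n\<^sub>,\<^sub>n\<^sub>+\<^sub>1\<close>.  The maps \<open>g n\<close> are the simplicial
  approximations before relabelling; subdivision does not change the realization, so no
  identification of realizations is needed.
\<close>

definition finite_approximative_sequence ::
    "'a::euclidean_space set set \<Rightarrow> ('a \<Rightarrow> 'a) \<Rightarrow>
     (nat \<Rightarrow> 'a set rel) \<Rightarrow> (nat \<Rightarrow> 'a set \<Rightarrow> 'a set) \<Rightarrow> (nat \<Rightarrow> 'a set \<Rightarrow> 'a set) \<Rightarrow> bool" where
  "finite_approximative_sequence K f X h ff \<longleftrightarrow>
     (\<exists>(\<phi> :: nat \<Rightarrow> nat) (g :: nat \<Rightarrow> 'a \<Rightarrow> 'a) (k :: nat \<Rightarrow> nat).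
        strict_mono \<phi> \<and>
        (\<forall>n. simplicial_map (iter_subdivision K (\<phi> n)) (iter_subdivision K n) (g n) \<and>
             simplicially_close (iter_subdivision K (\<phi> n)) (iter_subdivision K n) (g n) f) \<and>
        k 0 = 0 \<and> (\<forall>n. k (Suc n) = \<phi> (k n)) \<and> strict_mono k \<and>
        (\<forall>n. X n = fin_space K (k n)) \<and>
        (\<forall>n. h n = natural_map K (k n) (k (Suc n))) \<and>
        (\<forall>n. ff n = image (g (k n))))"

text \<open>\<open>multi_map X h ff n\<close> is the multivalued map \<open>F\<^sub>n\<^sub>+\<^sub>1\<close>.\<close>

definition multi_map ::
    "(nat \<Rightarrow> 'p rel) \<Rightarrow> (nat \<Rightarrow> 'p \<Rightarrow> 'p) \<Rightarrow> (nat \<Rightarrow> 'p \<Rightarrow> 'p) \<Rightarrow> nat \<Rightarrow> 'p \<Rightarrow> 'p set" where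
  "multi_map X h ff n x = {y \<in> Field (X (Suc n)). h n y = ff n x}"

end

theory Submission
  imports Defs
begin

text \<open>
  For \<open>n \<ge> 1\<close> the finite space \<open>X\<^sup>n\<close> is the set of simplices of the subdivision
  \<open>K\<^sup>n\<close> ordered by inclusion, and the natural map sends a simplex of a finer subdivision to the
  smallest simplex of the coarser one that contains it
  (\<open>subset_natural_map\<close>, \<open>natural_map_carrier\<close>).  The condition
  \<open>x\<^sub>n\<^sub>+\<^sub>1 \<in> F\<^sub>n\<^sub>+\<^sub>1(x\<^sub>n\<^sub>+\<^sub>1)\<close> on a coherent sequence therefore says, for these \<open>n\<close>, that the simplicial approximation
  maps the simplex \<open>x\<^sub>n\<^sub>+\<^sub>1\<close> onto the simplex \<open>x\<^sub>n\<close> around it.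

  If this holds from some index on, the points of \<open>x\<^sub>n\<^sub>+\<^sub>1\<close> are moved by the approximation by at most
  the mesh of a subdivision, and the approximation differs from \<open>f\<close> by at most the mesh.
  The mesh tends to zero (\<open>mesh_iter_tendsto_0\<close>), so \<open>dist p (f p)\<close> takes arbitrarily
  small values on the compact polyhedron, and its minimum is zero.

  Conversely, let \<open>f p = p\<close> and let \<open>x\<^sub>n\<close> be the carrier of \<open>p\<close>, the simplex with \<open>p\<close> in
  its relative interior.  Carriers are compatible with the natural maps.  An arbitrary
  simplicial approximation sends the carrier of \<open>p\<close> only to some face of the coarser carrier, so the
  approximation has to be chosen.  All points near \<open>p\<close> are mapped by \<open>f\<close> into the open stars of
  all vertices of \<open>x\<^sub>n\<close>, so the vertices of a sufficiently small carrier may be sent to the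
  vertices of \<open>x\<^sub>n\<close> in any way (\<open>ex_simplicial_approximation\<close>).  They can be sent onto them when
  the two carriers have equally many vertices, and this is so from some stage on, because the
  dimension of the carrier of \<open>p\<close> does not increase under subdivision
  (\<open>card_verts_carrier_stabilizes\<close>).

  Underlying both directions is the fact that barycentric subdivision yields a complex again, with
  the same polyhedron.  In barycentric coordinates, a point of the
  simplex spanned by the barycenters of a chain is a combination of the indicator functions of the
  vertex sets of the chain.  Its superlevel sets at positive levels are the members of the chain with positive weight,
  so the point determines chain and weights (\<open>chain_coords_unique\<close>), and every coordinate
  vector has such a decomposition (\<open>layer_cake\<close>).
\<close>

section \<open>Layered sums over nested families of sets\<close>

definition nested :: "('i \<Rightarrow> 'b set) \<Rightarrow> 'i set \<Rightarrow> bool" where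
  "nested V C \<longleftrightarrow> (\<forall>i\<in>C. \<forall>j\<in>C. V i \<subseteq> V j \<or> V j \<subseteq> V i)"

definition layer_sum :: "('i \<Rightarrow> 'b set) \<Rightarrow> 'i set \<Rightarrow> ('i \<Rightarrow> real) \<Rightarrow> 'b \<Rightarrow> real" where
  "layer_sum V C \<mu> u = (\<Sum>i\<in>C. if u \<in> V i then \<mu> i else 0)"

lemma nestedD: "nested V C \<Longrightarrow> i \<in> C \<Longrightarrow> j \<in> C \<Longrightarrow> V i \<subseteq> V j \<or> V j \<subseteq> V i"
  unfolding nested_def by blast

lemma nested_subset: "nested V C \<Longrightarrow> D \<subseteq> C \<Longrightarrow> nested V D"
  unfolding nested_def by blast

lemma nested_has_top:
  assumes "finite C" "C \<noteq> {}" "nested V C"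
  obtains i where "i \<in> C" "\<And>j. j \<in> C \<Longrightarrow> V j \<subseteq> V i"
proof -
  have "\<exists>m\<in>V ` C. \<forall>b\<in>V ` C. m \<subseteq> b \<longrightarrow> m = b"
    using assms(1,2) by (intro finite_has_maximal) auto
  then obtain i where i: "i \<in> C" "\<And>j. j \<in> C \<Longrightarrow> V i \<subseteq> V j \<Longrightarrow> V i = V j" by auto
  have "V j \<subseteq> V i" if "j \<in> C" for j
    using i(2)[OF that] assms(3) i(1) that unfolding nested_def by blast
  with i(1) show thesis by (rule that)
qed

lemma nested_has_bottom:
  assumes "finite C" "C \<noteq> {}" "nested V C"
  obtains i where "i \<in> C" "\<And>j. j \<in> C \<Longrightarrow> V i \<subseteq> V j"
proof -
  have "\<exists>m\<in>V ` C. \<forall>b\<in>V ` C. b \<subseteq> m \<longrightarrow> m = b"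
    using assms(1,2) by (intro finite_has_minimal) auto
  then obtain i where i: "i \<in> C" "\<And>j. j \<in> C \<Longrightarrow> V j \<subseteq> V i \<Longrightarrow> V i = V j" by auto
  have "V i \<subseteq> V j" if "j \<in> C" for j
    using i(2)[OF that] assms(3) i(1) that unfolding nested_def by blast
  with i(1) show thesis by (rule that)
qed

text \<open>
  Every smaller member of the family lies in the largest one among those properly contained in
  \<open>V i\<close>, so a point of \<open>V i\<close> outside that one lies only in members that contain \<open>V i\<close>.
  At such points a layered sum takes the level at which \<open>V i\<close> is its superlevel set.
\<close>

lemma nested_new_element:
  assumes "finite C" "nested V C" "i \<in> C" "V i \<noteq> {}"
  obtains v where "v \<in> V i" "\<And>j. j \<in> C \<Longrightarrow> v \<in> V j \<Longrightarrow> V i \<subseteq> V j"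
proof (cases "{j \<in> C. V j \<subset> V i} = {}")
  case True
  obtain v where v: "v \<in> V i" using assms(4) by blast
  have "V i \<subseteq> V j" if "j \<in> C" for j
    using nestedD[OF assms(2) that assms(3)] True that by auto
  then show thesis using that v by simp
next
  case False
  obtain k where k: "k \<in> {j \<in> C. V j \<subset> V i}" "\<And>j. j \<in> {j \<in> C. V j \<subset> V i} \<Longrightarrow> V j \<subseteq> V k"
    using nested_has_top[OF _ False, of V] assms(1) nested_subset[OF assms(2), of "{j \<in> C. V j \<subset> V i}"]
    by auto
  then obtain v where v: "v \<in> V i" "v \<notin> V k" by blast
  have "V i \<subseteq> V j" if j: "j \<in> C" "v \<in> V j" for j
    using k(2)[of j] v j nestedD[OF assms(2) assms(3) j(1)] by auto
  with v(1) show thesis by (rule that)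
qed

text \<open>
  A point outside \<open>V i\<close> lies only in members that properly contain \<open>V i\<close>, all of which contain
  \<open>v\<close>, so the sum there is smaller by at least the weight of \<open>V i\<close>.  Hence the family can be
  recovered from the sum.
\<close>

lemma superlevel_set_eq:
  assumes "finite C" "nested V C" "\<And>i. i \<in> C \<Longrightarrow> 0 < \<mu> i" "i \<in> C" "v \<in> V i"
    and new: "\<And>j. j \<in> C \<Longrightarrow> v \<in> V j \<Longrightarrow> V i \<subseteq> V j"
  shows "V i = {u. layer_sum V C \<mu> v \<le> layer_sum V C \<mu> u}"
proof -
  have in_level: "layer_sum V C \<mu> v \<le> layer_sum V C \<mu> u" if "u \<in> V i" for u
    unfolding layer_sum_def using that new assms(3)
    by (intro sum_mono) (auto simp: less_imp_le)
  have "layer_sum V C \<mu> u < layer_sum V C \<mu> v" if u: "u \<notin> V i" for u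
    unfolding layer_sum_def
  proof (rule sum_strict_mono_ex1[OF assms(1)])
    have "v \<in> V j" if "j \<in> C" "u \<in> V j" for j
      using that u assms(5) nestedD[OF assms(2,4) that(1)] by auto
    then show "\<forall>j\<in>C. (if u \<in> V j then \<mu> j else 0) \<le> (if v \<in> V j then \<mu> j else 0)"
      using assms(3) by (auto simp: less_imp_le)
    show "\<exists>j\<in>C. (if u \<in> V j then \<mu> j else 0) < (if v \<in> V j then \<mu> j else 0)"
      using u assms(3-5) by (intro bexI[of _ i]) auto
  qed
  then have "u \<in> V i \<longleftrightarrow> layer_sum V C \<mu> v \<le> layer_sum V C \<mu> u" for u
    using in_level[of u] by (cases "u \<in> V i") (simp_all add: not_le)
  then show ?thesis by blast
qed

lemma layer_sum_pos_iff:
  assumes "finite C" "\<And>i. i \<in> C \<Longrightarrow> 0 < \<mu> i"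
  shows "0 < layer_sum V C \<mu> u \<longleftrightarrow> (\<exists>i\<in>C. u \<in> V i)"
proof
  show "\<exists>i\<in>C. u \<in> V i" if "0 < layer_sum V C \<mu> u"
  proof (rule ccontr)
    assume "\<not> (\<exists>i\<in>C. u \<in> V i)"
    then have "layer_sum V C \<mu> u = 0" unfolding layer_sum_def by (intro sum.neutral) auto
    with that show False by simp
  qed
next
  assume "\<exists>i\<in>C. u \<in> V i"
  then obtain i where "i \<in> C" "u \<in> V i" by blast
  then show "0 < layer_sum V C \<mu> u"
    unfolding layer_sum_def using assms
    by (intro sum_pos2[where i = i]) (auto simp: less_imp_le)
qed

text \<open>
  Each member \<open>V i\<close> is the superlevel set of the common function at a new point \<open>v\<close> of
  \<open>V i\<close>.  The smallest member of the second family around \<open>v\<close> is the same superlevel set,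
  hence the same member.
\<close>

lemma layer_sum_determines_subset:
  assumes "finite C" "finite D" "nested V C" "nested V D"
    and "inj_on V (C \<union> D)" "\<And>i. i \<in> C \<Longrightarrow> V i \<noteq> {}"
    and "\<And>i. i \<in> C \<Longrightarrow> 0 < \<mu> i" "\<And>i. i \<in> D \<Longrightarrow> 0 < \<nu> i"
    and eq: "layer_sum V C \<mu> = layer_sum V D \<nu>"
  shows "C \<subseteq> D"
proof
  fix i assume i: "i \<in> C"
  obtain v where v: "v \<in> V i" "\<And>j. j \<in> C \<Longrightarrow> v \<in> V j \<Longrightarrow> V i \<subseteq> V j"
    using nested_new_element[OF assms(1,3) i assms(6)[OF i]] by blast
  have Vi: "V i = {u. layer_sum V C \<mu> v \<le> layer_sum V C \<mu> u}"
    by (rule superlevel_set_eq) (use assms i v in auto)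
  have "0 < layer_sum V D \<nu> v"
    using layer_sum_pos_iff[of C \<mu> V v] assms i v(1) by auto
  then have ne: "{j \<in> D. v \<in> V j} \<noteq> {}"
    using layer_sum_pos_iff[of D \<nu> V v] assms by auto
  obtain j where j: "j \<in> {j \<in> D. v \<in> V j}" "\<And>k. k \<in> {j \<in> D. v \<in> V j} \<Longrightarrow> V j \<subseteq> V k"
    using nested_has_bottom[OF _ ne, of V] assms(2,4) nested_subset[of V D "{j \<in> D. v \<in> V j}"] by auto
  have "V j = {u. layer_sum V D \<nu> v \<le> layer_sum V D \<nu> u}"
    by (rule superlevel_set_eq) (use assms j in auto)
  then have "V i = V j" using Vi eq by simp
  then have "i = j" using assms(5) i j by (auto dest: inj_onD)
  then show "i \<in> D" using j by blast
qed

text \<open>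
  Indicator functions of distinct nested sets are linearly independent: at a new point of the
  largest member where the weights differ, all other contributions agree.
\<close>

lemma layer_sum_determines_weights:
  assumes "finite C" "nested V C" "inj_on V C" "\<And>i. i \<in> C \<Longrightarrow> V i \<noteq> {}"
    and eq: "layer_sum V C \<mu> = layer_sum V C \<nu>" and "i \<in> C"
  shows "\<mu> i = \<nu> i"
proof (rule ccontr)
  assume neq: "\<mu> i \<noteq> \<nu> i"
  let ?B = "{j \<in> C. \<mu> j \<noteq> \<nu> j}"
  obtain k where k: "k \<in> ?B" "\<And>j. j \<in> ?B \<Longrightarrow> V j \<subseteq> V k"
    using nested_has_top[of ?B V] neq assms(1,6) nested_subset[OF assms(2), of ?B] by auto
  obtain v where v: "v \<in> V k" "\<And>j. j \<in> C \<Longrightarrow> v \<in> V j \<Longrightarrow> V k \<subseteq> V j"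
    using nested_new_element[OF assms(1,2), of k] assms(4) k by blast
  have *: "\<mu> j = \<nu> j" if "j \<in> C" "v \<in> V j" "j \<noteq> k" for j
  proof (rule ccontr)
    assume "\<mu> j \<noteq> \<nu> j"
    then have "V j = V k" using k(2)[of j] v(2)[of j] that by auto
    then show False using assms(3) that k(1) by (auto dest: inj_onD)
  qed
  have split: "layer_sum V C \<rho> v = \<rho> k + (\<Sum>j\<in>C - {k}. if v \<in> V j then \<rho> j else 0)" for \<rho>
    unfolding layer_sum_def using assms(1) k(1) v(1) by (subst sum.remove[of _ k]) auto
  have "(\<Sum>j\<in>C - {k}. if v \<in> V j then \<mu> j else 0) = (\<Sum>j\<in>C - {k}. if v \<in> V j then \<nu> j else 0)"
    using * by (intro sum.cong) auto
  then have "\<mu> k = \<nu> k" using split[of \<mu>] split[of \<nu>] fun_cong[OF eq, of v] by simp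
  then show False using k(1) by blast
qed

text \<open>
  Subtract the smallest positive value from \<open>c\<close> on the whole support, which becomes the
  outermost layer, and repeat on the strictly smaller support of what is left.
\<close>

lemma layer_cake:
  fixes c :: "'b \<Rightarrow> real"
  assumes "finite {v. 0 < c v}" "\<And>v. 0 \<le> c v"
  shows "\<exists>\<C> \<mu>. finite \<C> \<and> nested (\<lambda>V. V) \<C> \<and> (\<forall>V\<in>\<C>. V \<noteq> {} \<and> V \<subseteq> {v. 0 < c v} \<and> 0 < \<mu> V) \<and>
           layer_sum (\<lambda>V. V) \<C> \<mu> = c"
  using assms
proof (induction "card {v. 0 < c v}" arbitrary: c rule: less_induct)
  case less
  let ?S = "{v. 0 < c v}"
  show ?case
  proof (cases "?S = {}")
    case True
    then have "c v = 0" for v using less.prems(2)[of v] by (auto simp: less_le)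
    then have "layer_sum (\<lambda>V. V) {} (\<lambda>_. 0) = c"
      by (simp add: layer_sum_def fun_eq_iff)
    then show ?thesis
      by (intro exI[of _ "{}"] exI[of _ "\<lambda>_. 0"]) (simp add: nested_def)
  next
    case False
    obtain v0 where v0: "v0 \<in> ?S" "\<And>v. v \<in> ?S \<Longrightarrow> c v0 \<le> c v"
      using arg_min_if_finite[OF less.prems(1) False, of c] not_less by metis
    define d where "d = (\<lambda>v. c v - (if v \<in> ?S then c v0 else 0))"
    have sub: "{v. 0 < d v} \<subset> ?S"
      using v0 less.prems(2) by (auto simp: d_def split: if_splits)
    have d0: "0 \<le> d v" for v using v0(2) less.prems(2) by (auto simp: d_def)
    obtain \<D> \<mu> where D: "finite \<D>" "nested (\<lambda>V. V) \<D>"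
      "\<And>V. V \<in> \<D> \<Longrightarrow> V \<noteq> {} \<and> V \<subseteq> {v. 0 < d v} \<and> 0 < \<mu> V" "layer_sum (\<lambda>V. V) \<D> \<mu> = d"
      using less.hyps[of d] d0 less.prems(1) psubset_card_mono[OF less.prems(1) sub]
        finite_subset[OF psubset_imp_subset[OF sub]] by blast
    have nin: "?S \<notin> \<D>" using D(3) sub by blast
    have "layer_sum (\<lambda>V. V) (insert ?S \<D>) (\<mu>(?S := c v0)) v = c v" for v
    proof -
      have "(\<Sum>V\<in>\<D>. if v \<in> V then (\<mu>(?S := c v0)) V else 0) = layer_sum (\<lambda>V. V) \<D> \<mu> v"
        unfolding layer_sum_def using nin by (intro sum.cong) auto
      then show ?thesis
        using D(1) nin fun_cong[OF D(4), of v] by (simp add: layer_sum_def d_def del: fun_upd_apply) (simp add: layer_sum_def d_def)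
    qed
    then have "layer_sum (\<lambda>V. V) (insert ?S \<D>) (\<mu>(?S := c v0)) = c" by blast
    moreover have "nested (\<lambda>V. V) (insert ?S \<D>)"
      using D(2,3) sub unfolding nested_def by blast
    moreover have "\<forall>V\<in>insert ?S \<D>. V \<noteq> {} \<and> V \<subseteq> ?S \<and> 0 < (\<mu>(?S := c v0)) V"
      using D(3) sub v0(1) False by auto
    ultimately show ?thesis using D(1) by blast
  qed
qed

section \<open>Barycentric coordinates\<close>

text \<open>
  The coordinate function is defined on the whole space and vanishes off \<open>V\<close>, so that
  coordinates with respect to different simplices can be compared as functions.
\<close>

definition bary_coords :: "'a::real_vector set \<Rightarrow> ('a \<Rightarrow> real) \<Rightarrow> 'a \<Rightarrow> bool" where
  "bary_coords V c x \<longleftrightarrow>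
     (\<forall>v. 0 \<le> c v) \<and> (\<forall>v. v \<notin> V \<longrightarrow> c v = 0) \<and> sum c V = 1 \<and> (\<Sum>v\<in>V. c v *\<^sub>R v) = x"

lemma in_convex_hull_iff_bary_coords:
  assumes "finite V"
  shows "x \<in> convex hull V \<longleftrightarrow> (\<exists>c. bary_coords V c x)"
proof
  assume "x \<in> convex hull V"
  then obtain u where u: "\<forall>v\<in>V. 0 \<le> u v" "sum u V = 1" "(\<Sum>v\<in>V. u v *\<^sub>R v) = x"
    using convex_hull_finite[OF assms] by auto
  have "bary_coords V (\<lambda>v. if v \<in> V then u v else 0) x"
    unfolding bary_coords_def using u by (auto intro!: sum.cong)
  then show "\<exists>c. bary_coords V c x" by blast
next
  assume "\<exists>c. bary_coords V c x"
  then show "x \<in> convex hull V"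
    unfolding convex_hull_finite[OF assms] bary_coords_def by blast
qed

lemma bary_coords_mono:
  assumes "bary_coords V c x" "V \<subseteq> W" "finite W"
  shows "bary_coords W c x"
proof -
  have "sum c W = sum c V" "(\<Sum>v\<in>W. c v *\<^sub>R v) = (\<Sum>v\<in>V. c v *\<^sub>R v)"
    by (rule sum.mono_neutral_right; use assms in \<open>auto simp: bary_coords_def\<close>)+
  then show ?thesis using assms(1,2) unfolding bary_coords_def by auto
qed

lemma bary_coords_support:
  assumes "bary_coords V c x" "finite V"
  shows "{v. 0 < c v} \<subseteq> V" "{v. 0 < c v} \<noteq> {}" "bary_coords {v. 0 < c v} c x"
proof -
  have c: "\<And>v. 0 \<le> c v" "\<And>v. v \<notin> V \<Longrightarrow> c v = 0" "sum c V = 1" "(\<Sum>v\<in>V. c v *\<^sub>R v) = x"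
    using assms(1) unfolding bary_coords_def by auto
  show sub: "{v. 0 < c v} \<subseteq> V" using c(2) by force
  have z: "c v = 0" if "\<not> 0 < c v" for v using c(1)[of v] that by linarith
  show "{v. 0 < c v} \<noteq> {}" using c(3) z by (metis empty_Collect_eq sum.neutral zero_neq_one)
  have "sum c V = sum c {v. 0 < c v}" "(\<Sum>v\<in>V. c v *\<^sub>R v) = (\<Sum>v\<in>{v. 0 < c v}. c v *\<^sub>R v)"
    by (rule sum.mono_neutral_right; use sub z assms(2) in auto)+
  then show "bary_coords {v. 0 < c v} c x"
    unfolding bary_coords_def using c z by auto
qed

lemma bary_coords_vertex:
  "finite V \<Longrightarrow> v \<in> V \<Longrightarrow> bary_coords V (\<lambda>u. if u = v then 1 else 0) v"
  unfolding bary_coords_def by (auto simp: if_distrib[of "\<lambda>a. a *\<^sub>R _"] cong: if_cong)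

lemma bary_coords_affine:
  assumes "bary_coords V c x" "bary_coords V d y" "t \<in> {0..1}"
  shows "bary_coords V (\<lambda>v. (1 - t) * c v + t * d v) ((1 - t) *\<^sub>R x + t *\<^sub>R y)"
proof -
  have c: "\<And>v. 0 \<le> c v" "\<And>v. v \<notin> V \<Longrightarrow> c v = 0" "sum c V = 1" "(\<Sum>v\<in>V. c v *\<^sub>R v) = x"
    and d: "\<And>v. 0 \<le> d v" "\<And>v. v \<notin> V \<Longrightarrow> d v = 0" "sum d V = 1" "(\<Sum>v\<in>V. d v *\<^sub>R v) = y"
    using assms unfolding bary_coords_def by auto
  have "(\<Sum>v\<in>V. (1 - t) * c v + t * d v) = (1 - t) * sum c V + t * sum d V"
    by (simp only: sum.distrib sum_distrib_left)
  moreover have "(\<Sum>v\<in>V. ((1 - t) * c v + t * d v) *\<^sub>R v) =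
      (1 - t) *\<^sub>R (\<Sum>v\<in>V. c v *\<^sub>R v) + t *\<^sub>R (\<Sum>v\<in>V. d v *\<^sub>R v)"
    by (simp only: scaleR_left_distrib sum.distrib scaleR_right.sum scaleR_scaleR)
  ultimately show ?thesis
    unfolding bary_coords_def using c d assms(3) by simp
qed

text \<open>
  From left to right, the positive and the negative part of an affine dependence, both divided by
  their common sum, are two coordinate vectors of one point.  Conversely, the difference of two
  coordinate vectors of one point is an affine dependence.
\<close>

lemma affine_dependent_iff_coords_not_unique:
  fixes V :: "'a::real_vector set"
  assumes "finite V"
  shows "affine_dependent V \<longleftrightarrow> (\<exists>x c d. bary_coords V c x \<and> bary_coords V d x \<and> c \<noteq> d)"
proof
  assume "affine_dependent V"
  then obtain U where U: "sum U V = 0" "\<exists>v\<in>V. U v \<noteq> 0" "(\<Sum>v\<in>V. U v *\<^sub>R v) = 0"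
    using affine_dependent_explicit_finite[OF assms] by blast
  \<comment> \<open>The positive and negative parts of the dependence and their common total.\<close>
  define p q s where "p = (\<lambda>v. if v \<in> V then max (U v) 0 else 0)"
    and "q = (\<lambda>v. if v \<in> V then max (- U v) 0 else 0)" and "s = sum p V"
  have pq: "p v - q v = U v" "0 \<le> p v" "0 \<le> q v" if "v \<in> V" for v
    using that by (auto simp: p_def q_def)
  have "sum p V - sum q V = sum U V" using pq by (simp flip: sum_subtractf)
  then have sq: "sum q V = s" using U by (simp add: s_def)
  have "s \<noteq> 0"
  proof
    assume "s = 0"
    then have "\<forall>v\<in>V. p v = 0" "\<forall>v\<in>V. q v = 0"
      using sq pq assms by (auto simp: s_def sum_nonneg_eq_0_iff)
    then show False using U(2) pq(1) by (metis diff_zero)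
  qed
  then have s: "0 < s" using sum_nonneg[of V p] pq(2) unfolding s_def by (simp add: less_le)
  have "(\<Sum>v\<in>V. p v *\<^sub>R v) - (\<Sum>v\<in>V. q v *\<^sub>R v) = (\<Sum>v\<in>V. U v *\<^sub>R v)"
    using pq by (simp flip: sum_subtractf scaleR_left_diff_distrib)
  then have e: "(\<Sum>v\<in>V. p v *\<^sub>R v) = (\<Sum>v\<in>V. q v *\<^sub>R v)" using U by simp
  have "bary_coords V (\<lambda>v. r v / s) ((\<Sum>v\<in>V. r v *\<^sub>R v) /\<^sub>R s)"
    if "r = p \<or> r = q" for r
  proof -
    have "(\<Sum>v\<in>V. r v / s) = sum r V / s" by (simp only: sum_divide_distrib)
    moreover have "sum r V = s" using that sq by (auto simp: s_def)
    moreover have "(\<Sum>v\<in>V. (r v / s) *\<^sub>R v) = (\<Sum>v\<in>V. r v *\<^sub>R v) /\<^sub>R s"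
      by (simp add: scaleR_right.sum divide_inverse mult.commute)
    moreover have "0 \<le> r v / s" "v \<notin> V \<Longrightarrow> r v / s = 0" for v
      using that s by (auto simp: p_def q_def)
    ultimately show ?thesis unfolding bary_coords_def using s by simp
  qed
  moreover have "(\<lambda>v. p v / s) \<noteq> (\<lambda>v. q v / s)"
    using U(2) pq(1) s by (metis cancel_comm_monoid_add_class.diff_cancel divide_cancel_right less_irrefl)
  ultimately show "\<exists>x c d. bary_coords V c x \<and> bary_coords V d x \<and> c \<noteq> d"
    using e by metis
next
  assume "\<exists>x c d. bary_coords V c x \<and> bary_coords V d x \<and> c \<noteq> d"
  then obtain x c d where cd: "bary_coords V c x" "bary_coords V d x" "c \<noteq> d" by blast
  then have "\<exists>v\<in>V. c v - d v \<noteq> 0" unfolding bary_coords_def by (metis eq_iff_diff_eq_0 ext)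
  moreover have "sum (\<lambda>v. c v - d v) V = 0" "(\<Sum>v\<in>V. (c v - d v) *\<^sub>R v) = 0"
    using cd unfolding bary_coords_def by (simp_all add: sum_subtractf scaleR_left_diff_distrib)
  ultimately show "affine_dependent V"
    unfolding affine_dependent_explicit_finite[OF assms] by blast
qed

section \<open>Geometric simplicial complexes\<close>

text \<open>
  The geometric condition is injectivity of the realization: a point of the polyhedron has the
  same barycentric coordinates in every simplex containing it.  For finite complexes this amounts to
  simplices meeting in common faces, but it is a statement about coordinate functions, and in this
  form it passes to the barycentric subdivision by a computation with layered sums.
\<close>

locale geometric_complex =
  fixes L :: "'a::euclidean_space set set"
  assumes finite_complex: "finite L"
    and finite_verts: "S \<in> simplices L \<Longrightarrow> finite (verts S)"
    and hull_verts: "S \<in> simplices L \<Longrightarrow> convex hull verts S = S"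
    and face_closed: "S \<in> simplices L \<Longrightarrow> V \<subseteq> verts S \<Longrightarrow> V \<noteq> {} \<Longrightarrow> convex hull V \<in> simplices L"
    and verts_hull: "S \<in> simplices L \<Longrightarrow> V \<subseteq> verts S \<Longrightarrow> verts (convex hull V) = V"
    and coords_unique: "S \<in> simplices L \<Longrightarrow> T \<in> simplices L \<Longrightarrow>
      bary_coords (verts S) c x \<Longrightarrow> bary_coords (verts T) d x \<Longrightarrow> c = d"

lemma verts_convex_hull: "\<not> affine_dependent V \<Longrightarrow> verts (convex hull V) = V"
  for V :: "'a::euclidean_space set"
  by (simp add: verts_def extreme_point_of_convex_hull_affine_independent)

text \<open>
  Two simplices containing a point meet in a common face.  Coordinates with respect to that face are
  coordinates with respect to both simplices, and those are unique by affine independence.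
\<close>

lemma simplicial_complex_imp_geometric_complex:
  fixes K :: "'a::euclidean_space set set"
  assumes K: "simplicial_complex K"
  shows "geometric_complex K"
proof -
  have fin: "finite K" and sx: "\<And>S. S \<in> K \<Longrightarrow> \<exists>n. n simplex S"
    and face: "\<And>F S. S \<in> K \<Longrightarrow> F face_of S \<Longrightarrow> F \<in> K"
    and int: "\<And>S T. S \<in> K \<Longrightarrow> T \<in> K \<Longrightarrow> S \<inter> T face_of S"
    using K unfolding simplicial_complex_def by blast+
  have ind: "\<not> affine_dependent (verts S) \<and> finite (verts S) \<and> convex hull verts S = S"
    if S: "S \<in> simplices K" for S
  proof -
    obtain C where C: "\<not> affine_dependent C" "S = convex hull C"
      using sx[of S] S unfolding simplices_def simplex_def by blast
    then have "verts S = C" by (simp add: verts_convex_hull)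
    with C show ?thesis by (simp add: aff_independent_finite)
  qed
  have hull: "convex hull V \<in> simplices K" if "S \<in> simplices K" "V \<subseteq> verts S" "V \<noteq> {}" for S V
  proof -
    have "convex hull V face_of S"
      using face_of_convex_hull_affine_independent[of "verts S" "convex hull V"] ind[OF that(1)] that(2) by auto
    then show ?thesis using face that unfolding simplices_def by auto
  qed
  have vh: "verts (convex hull V) = V" if "S \<in> simplices K" "V \<subseteq> verts S" for S V
    using verts_convex_hull affine_independent_subset ind that by metis
  have uniq: "c = d" if S: "S \<in> simplices K" and T: "T \<in> simplices K"
    and c: "bary_coords (verts S) c x" and d: "bary_coords (verts T) d x" for S T c d x
  proof -
    have x: "x \<in> S" "x \<in> T"
      using in_convex_hull_iff_bary_coords ind S T c d by metis+
    have "S \<inter> T face_of convex hull verts S" "S \<inter> T face_of convex hull verts T"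
      using int[of S T] int[of T S] S T ind unfolding simplices_def by (auto simp: Int_commute)
    then obtain V W where V: "V \<subseteq> verts S" "S \<inter> T = convex hull V"
      and W: "W \<subseteq> verts T" "S \<inter> T = convex hull W"
      using face_of_convex_hull_affine_independent ind S T by metis
    have "V = W" using vh[OF S V(1)] vh[OF T W(1)] V(2) W(2) by simp
    have finV: "finite V" using V(1) ind[OF S] finite_subset by blast
    obtain e where e: "bary_coords V e x"
      using x V(2) in_convex_hull_iff_bary_coords[OF finV] by blast
    have "bary_coords (verts S) e x" "bary_coords (verts T) e x"
      using bary_coords_mono[OF e] V(1) W(1) \<open>V = W\<close> ind S T by blast+
    then show "c = d"
      using c d affine_dependent_iff_coords_not_unique ind S T by metis
  qed
  show ?thesis
    by standard (use fin ind hull vh uniq in auto)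
qed

definition coords :: "'a::euclidean_space set set \<Rightarrow> 'a \<Rightarrow> 'a \<Rightarrow> real" where
  "coords L x = (THE c. \<exists>S\<in>simplices L. bary_coords (verts S) c x)"

text \<open>
  The carrier is the unique simplex that contains the point in its relative interior; it is
  spanned by the vertices with positive coordinate.
\<close>

definition carrier :: "'a::euclidean_space set set \<Rightarrow> 'a \<Rightarrow> 'a set" where
  "carrier L x = convex hull {v. 0 < coords L x v}"

lemma Union_simplices: "\<Union>(simplices L) = \<Union>L"
  unfolding simplices_def by auto

lemma Chains_face_poset:
  "C \<in> Chains (face_poset L) \<longleftrightarrow> C \<subseteq> simplices L \<and> nested (\<lambda>S. S) C"
  unfolding Chains_def face_poset_def nested_def by blast

context geometric_complex
begin

lemma verts_nonempty: "S \<in> simplices L \<Longrightarrow> verts S \<noteq> {}"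
  using hull_verts unfolding simplices_def by force

lemma card_verts_pos: "S \<in> simplices L \<Longrightarrow> 0 < card (verts S)"
  using finite_verts verts_nonempty by (simp add: card_gt_0_iff)

lemma verts_subset: "S \<in> simplices L \<Longrightarrow> verts S \<subseteq> S"
  using hull_verts hull_subset by metis

lemma coords_eq:
  assumes "S \<in> simplices L" "bary_coords (verts S) c x"
  shows "coords L x = c"
  unfolding coords_def
proof (rule the_equality)
  show "\<exists>S\<in>simplices L. bary_coords (verts S) c x" using assms by blast
  show "d = c" if "\<exists>S\<in>simplices L. bary_coords (verts S) d x" for d
    using that assms coords_unique by blast
qed

lemma bary_coords_coords:
  assumes "S \<in> simplices L" "x \<in> S"
  shows "bary_coords (verts S) (coords L x) x"
proof -
  obtain c where "bary_coords (verts S) c x"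
    using assms hull_verts in_convex_hull_iff_bary_coords[OF finite_verts] by metis
  with coords_eq[OF assms(1)] show ?thesis by metis
qed

lemma coords_support_subset:
  assumes "S \<in> simplices L" "x \<in> S"
  shows "{v. 0 < coords L x v} \<subseteq> verts S"
  using bary_coords_support(1)[OF bary_coords_coords[OF assms] finite_verts[OF assms(1)]] .

lemma
  assumes "x \<in> \<Union>L"
  shows carrier_in: "carrier L x \<in> simplices L"
    and in_carrier: "x \<in> carrier L x"
    and verts_carrier: "verts (carrier L x) = {v. 0 < coords L x v}"
proof -
  obtain S where S: "S \<in> simplices L" "x \<in> S" using assms Union_simplices by blast
  note c = bary_coords_coords[OF S]
  note supp = bary_coords_support[OF c finite_verts[OF S(1)]]
  show "carrier L x \<in> simplices L" "verts (carrier L x) = {v. 0 < coords L x v}"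
    unfolding carrier_def using face_closed[OF S(1)] verts_hull[OF S(1)] supp by auto
  show "x \<in> carrier L x"
    unfolding carrier_def
    using in_convex_hull_iff_bary_coords[of "{v. 0 < coords L x v}"] supp finite_subset finite_verts[OF S(1)]
    by metis
qed

lemma simplex_subset_iff:
  assumes "S \<in> simplices L" "T \<in> simplices L"
  shows "S \<subseteq> T \<longleftrightarrow> verts S \<subseteq> verts T"
proof
  assume "S \<subseteq> T"
  show "verts S \<subseteq> verts T"
  proof
    fix v assume v: "v \<in> verts S"
    have "coords L v = (\<lambda>u. if u = v then 1 else 0)"
      using coords_eq[OF assms(1)] bary_coords_vertex[OF finite_verts[OF assms(1)] v] by blast
    moreover have "v \<in> T" using v verts_subset[OF assms(1)] \<open>S \<subseteq> T\<close> by blast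
    ultimately show "v \<in> verts T" using coords_support_subset[OF assms(2)] by force
  qed
next
  assume "verts S \<subseteq> verts T"
  then have "convex hull verts S \<subseteq> convex hull verts T" by (rule hull_mono)
  then show "S \<subseteq> T" using hull_verts assms by simp
qed

lemma inj_on_verts: "inj_on verts (simplices L)"
  using hull_verts by (metis inj_onI)

lemma bary_coords_barycenter:
  assumes "S \<in> simplices L"
  shows "bary_coords (verts S) (\<lambda>v. if v \<in> verts S then 1 / card (verts S) else 0) (barycenter S)"
  using finite_verts[OF assms] verts_nonempty[OF assms]
  unfolding bary_coords_def barycenter_def
  by (auto simp: scaleR_right.sum divide_inverse intro!: sum.cong)

lemma barycenter_in:
  assumes "S \<in> simplices L"
  shows "barycenter S \<in> S"
  using bary_coords_barycenter[OF assms] hull_verts[OF assms]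
    in_convex_hull_iff_bary_coords[OF finite_verts[OF assms]] by blast

lemma inj_on_barycenter: "inj_on barycenter (simplices L)"
proof (rule inj_onI)
  fix S T assume S: "S \<in> simplices L" and T: "T \<in> simplices L" and eq: "barycenter S = barycenter T"
  have "(\<lambda>v. if v \<in> verts S then 1 / real (card (verts S)) else 0) =
        (\<lambda>v. if v \<in> verts T then 1 / real (card (verts T)) else 0)"
    using coords_unique[OF S T bary_coords_barycenter[OF S]] bary_coords_barycenter[OF T] eq by simp
  then have "v \<in> verts S \<longleftrightarrow> v \<in> verts T" for v
    using finite_verts[OF S] verts_nonempty[OF S] finite_verts[OF T] verts_nonempty[OF T]
    by (drule_tac fun_cong[of _ _ v]) (auto split: if_splits)
  then show "S = T" using inj_on_verts S T by (metis inj_onD subsetI subset_antisym)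
qed

section \<open>Barycentric subdivision\<close>

lemma
  assumes "C \<in> Chains (face_poset L)"
  shows chain_subset: "C \<subseteq> simplices L" and finite_chain: "finite C"
    and nested_verts: "nested verts C"
    and inj_on_barycenter_chain: "inj_on barycenter C"
proof -
  show sub: "C \<subseteq> simplices L" using assms Chains_face_poset by blast
  show "finite C" using sub finite_complex unfolding simplices_def by (meson Diff_subset finite_subset)
  show "nested verts C"
    using assms sub unfolding Chains_face_poset nested_def by (metis simplex_subset_iff subsetD)
  show "inj_on barycenter C" using inj_on_barycenter sub by (rule inj_on_subset)
qed

lemma chain_Union:
  assumes "C \<in> Chains (face_poset L)" "C \<noteq> {}"
  shows "\<Union>C \<in> C" "\<And>S. S \<in> C \<Longrightarrow> verts S \<subseteq> verts (\<Union>C)"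
proof -
  obtain T where T: "T \<in> C" "\<And>S. S \<in> C \<Longrightarrow> S \<subseteq> T"
    using nested_has_top[OF finite_chain[OF assms(1)] assms(2), of "\<lambda>S. S"] assms(1)
    by (auto simp: Chains_face_poset)
  then have eq: "\<Union>C = T" by blast
  with T show "\<Union>C \<in> C" by simp
  show "verts S \<subseteq> verts (\<Union>C)" if "S \<in> C" for S
  proof -
    have "S \<in> simplices L" "T \<in> simplices L" using that T(1) chain_subset[OF assms(1)] by auto
    then show ?thesis using simplex_subset_iff T(2)[OF that] eq by simp
  qed
qed

text \<open>
  Since the barycenter of \<open>S\<close> is uniform on the vertices of \<open>S\<close>, a convex combination of the
  barycenters of a chain has coordinates that are a layered sum over the vertex sets of the
  chain.  This translates between the subdivision and the original complex.
\<close>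

lemma bary_coords_chain_sum:
  assumes C: "C \<in> Chains (face_poset L)" "C \<noteq> {}"
    and \<mu>: "\<And>S. S \<in> C \<Longrightarrow> 0 \<le> \<mu> S" "sum \<mu> C = 1"
  shows "bary_coords (verts (\<Union>C)) (layer_sum verts C (\<lambda>S. \<mu> S / card (verts S)))
           (\<Sum>S\<in>C. \<mu> S *\<^sub>R barycenter S)"
proof -
  let ?T = "\<Union>C" and ?w = "\<lambda>S. \<mu> S / real (card (verts S))"
  have T: "?T \<in> C" and top: "\<And>S. S \<in> C \<Longrightarrow> verts S \<subseteq> verts ?T"
    using chain_Union[OF C] by auto
  note sub = chain_subset[OF C(1)]
  have fT: "finite (verts ?T)" using T sub finite_verts by blast
  have swap: "(\<Sum>u\<in>verts ?T. layer_sum verts C ?w u *\<^sub>R g u) = (\<Sum>S\<in>C. ?w S *\<^sub>R (\<Sum>u\<in>verts S. g u))"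
    for g :: "'a \<Rightarrow> 'b::real_vector"
  proof -
    have "(\<Sum>u\<in>verts ?T. layer_sum verts C ?w u *\<^sub>R g u) =
        (\<Sum>S\<in>C. \<Sum>u\<in>verts ?T. (if u \<in> verts S then ?w S else 0) *\<^sub>R g u)"
      unfolding layer_sum_def scaleR_left.sum by (rule sum.swap)
    also have "\<dots> = (\<Sum>S\<in>C. \<Sum>u\<in>verts S. ?w S *\<^sub>R g u)"
      using top fT by (intro sum.cong refl sum.mono_neutral_cong_right) auto
    finally show ?thesis by (simp add: scaleR_right.sum)
  qed
  have "card (verts S) \<noteq> 0" if "S \<in> C" for S
    using card_verts_pos[OF subsetD[OF sub that]] by simp
  then have "(\<Sum>S\<in>C. ?w S *\<^sub>R (\<Sum>u\<in>verts S. (1::real))) = sum \<mu> C"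
    "(\<Sum>S\<in>C. ?w S *\<^sub>R (\<Sum>u\<in>verts S. u)) = (\<Sum>S\<in>C. \<mu> S *\<^sub>R barycenter S)"
    by (auto simp: barycenter_def divide_inverse intro!: sum.cong)
  then have "sum (layer_sum verts C ?w) (verts ?T) = 1"
    "(\<Sum>u\<in>verts ?T. layer_sum verts C ?w u *\<^sub>R u) = (\<Sum>S\<in>C. \<mu> S *\<^sub>R barycenter S)"
    using swap[of "\<lambda>_. 1::real"] swap[of "\<lambda>u. u"] \<mu>(2) by simp_all
  moreover have "0 \<le> layer_sum verts C ?w u" for u
    unfolding layer_sum_def using \<mu>(1) by (intro sum_nonneg) auto
  moreover have "layer_sum verts C ?w u = 0" if "u \<notin> verts ?T" for u
    unfolding layer_sum_def using that top by (intro sum.neutral) auto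
  ultimately show ?thesis unfolding bary_coords_def by blast
qed

text \<open>
  Barycenters with zero weight are dropped because the layered sum determines a chain only
  when all weights are positive.
\<close>

lemma coords_chain_point:
  assumes C: "C \<in> Chains (face_poset L)" and c: "bary_coords (barycenter ` C) c x"
  defines "P \<equiv> {S \<in> C. 0 < c (barycenter S)}"
  shows "P \<in> Chains (face_poset L)" "P \<noteq> {}" "barycenter ` P = {v. 0 < c v}"
    and "coords L x = layer_sum verts P (\<lambda>S. c (barycenter S) / card (verts S))"
    and "{v. 0 < coords L x v} = verts (\<Union>P)"
proof -
  note supp = bary_coords_support[OF c finite_imageI[OF finite_chain[OF C]]]
  show P: "P \<in> Chains (face_poset L)"
    using C nested_subset[of "\<lambda>S. S" C P] unfolding Chains_face_poset by (auto simp: P_def)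
  show im: "barycenter ` P = {v. 0 < c v}" using supp(1) by (auto simp: P_def)
  then show ne: "P \<noteq> {}" using supp(2) by auto
  have "sum (\<lambda>S. c (barycenter S)) P = 1" "(\<Sum>S\<in>P. c (barycenter S) *\<^sub>R barycenter S) = x"
    using supp(3) unfolding im[symmetric] bary_coords_def
    by (simp_all add: sum.reindex[OF inj_on_barycenter_chain[OF P]] o_def)
  then have "bary_coords (verts (\<Union>P)) (layer_sum verts P (\<lambda>S. c (barycenter S) / card (verts S))) x"
    using bary_coords_chain_sum[OF P ne, of "\<lambda>S. c (barycenter S)"] by (auto simp: P_def)
  moreover have PP: "\<Union>P \<in> P" "\<And>S. S \<in> P \<Longrightarrow> verts S \<subseteq> verts (\<Union>P)" using chain_Union[OF P ne] by auto
  ultimately show co: "coords L x = layer_sum verts P (\<lambda>S. c (barycenter S) / card (verts S))"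
    using coords_eq chain_subset[OF P] by blast
  have pos: "0 < c (barycenter S) / card (verts S)" if "S \<in> P" for S
  proof -
    have "S \<in> simplices L" using that chain_subset[OF P] by blast
    then show ?thesis using that card_verts_pos by (simp add: P_def)
  qed
  show "{v. 0 < coords L x v} = verts (\<Union>P)"
  proof -
    have "0 < layer_sum verts P (\<lambda>S. c (barycenter S) / card (verts S)) v \<longleftrightarrow> (\<exists>S\<in>P. v \<in> verts S)" for v
      by (rule layer_sum_pos_iff[OF finite_chain[OF P] pos])
    then show ?thesis unfolding co using PP by auto
  qed
qed

text \<open>
  The injectivity condition for the subdivision: the coordinates of \<open>x\<close> in the
  original complex are a layered sum, and such a sum determines its chain and its weights.
\<close>

lemma chain_coords_unique:
  assumes C: "C \<in> Chains (face_poset L)" and c: "bary_coords (barycenter ` C) c x"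
    and D: "D \<in> Chains (face_poset L)" and d: "bary_coords (barycenter ` D) d x"
  shows "c = d"
proof -
  let ?P = "{S \<in> C. 0 < c (barycenter S)}" and ?Q = "{S \<in> D. 0 < d (barycenter S)}"
  let ?\<mu> = "\<lambda>S. c (barycenter S) / real (card (verts S))"
    and ?\<nu> = "\<lambda>S. d (barycenter S) / real (card (verts S))"
  note P = coords_chain_point[OF C c] and Q = coords_chain_point[OF D d]
  have eq: "layer_sum verts ?P ?\<mu> = layer_sum verts ?Q ?\<nu>" using P(4) Q(4) by simp
  have sub: "?P \<subseteq> simplices L" "?Q \<subseteq> simplices L" using chain_subset C D by auto
  have inj: "inj_on verts (?P \<union> ?Q)" by (rule inj_on_subset[OF inj_on_verts]) (use sub in auto)
  have card: "0 < real (card (verts S))" if "S \<in> ?P \<or> S \<in> ?Q" for S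
    using that sub card_verts_pos by fastforce
  note fin = finite_chain[OF P(1)] finite_chain[OF Q(1)]
    and nest = nested_verts[OF P(1)] nested_verts[OF Q(1)]
  have ne: "verts S \<noteq> {}" if "S \<in> ?P \<or> S \<in> ?Q" for S using that sub verts_nonempty by blast
  have pos: "0 < ?\<mu> S" if "S \<in> ?P" for S using that card[of S] by simp
  have pos': "0 < ?\<nu> S" if "S \<in> ?Q" for S using that card[of S] by simp
  have PQ: "?P = ?Q"
  proof
    show "?P \<subseteq> ?Q"
      by (rule layer_sum_determines_subset[OF fin nest inj _ pos pos' eq]) (use ne in auto)
    show "?Q \<subseteq> ?P"
      by (rule layer_sum_determines_subset[OF fin(2,1) nest(2,1) _ _ pos' pos eq[symmetric]])
        (use ne inj in \<open>auto simp: Un_commute\<close>)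
  qed
  have weights: "c (barycenter S) = d (barycenter S)" if S: "S \<in> ?P" for S
  proof -
    have "?\<mu> S = ?\<nu> S"
      by (rule layer_sum_determines_weights[OF fin(1) nest(1) _ _ _ S])
        (use ne inj eq PQ in \<open>auto simp: inj_on_Un\<close>)
    then show ?thesis using card[of S] S by simp
  qed
  have c0: "0 \<le> c v" "0 \<le> d v" for v using c d unfolding bary_coords_def by auto
  show "c = d"
  proof
    fix v
    have 1: "v \<in> barycenter ` ?P \<longleftrightarrow> 0 < c v" unfolding P(3) by simp
    have 2: "v \<in> barycenter ` ?P \<longleftrightarrow> 0 < d v" unfolding PQ Q(3) by simp
    show "c v = d v"
    proof (cases "0 < c v")
      case True
      then have "v \<in> barycenter ` ?P" using 1 by simp
      then obtain S where S: "v = barycenter S" "S \<in> ?P" by (rule imageE)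
      show ?thesis unfolding S(1) by (rule weights[OF S(2)])
    next
      case False
      then show ?thesis using 1 2 c0[of v] by linarith
    qed
  qed
qed

lemma finite_chain_image: "C \<in> Chains (face_poset L) \<Longrightarrow> finite (barycenter ` C)"
  using finite_chain by blast

lemma chain_barycenters_independent:
  assumes "C \<in> Chains (face_poset L)"
  shows "\<not> affine_dependent (barycenter ` C)"
  using affine_dependent_iff_coords_not_unique[OF finite_chain_image[OF assms]]
    chain_coords_unique[OF assms _ assms] by blast

lemma verts_chain_simplex:
  "C \<in> Chains (face_poset L) \<Longrightarrow> verts (chain_simplex C) = barycenter ` C"
  unfolding chain_simplex_def by (intro verts_convex_hull chain_barycenters_independent)

lemma simplices_bary_subdivision:
  "simplices (bary_subdivision L) = chain_simplex ` (Chains (face_poset L) - {{}})"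
  unfolding simplices_def bary_subdivision_def chain_simplex_def by auto

lemma geometric_complex_bary_subdivision: "geometric_complex (bary_subdivision L)"
proof
  have "Chains (face_poset L) \<subseteq> Pow L"
    using chain_subset unfolding simplices_def by blast
  then show "finite (bary_subdivision L)"
    unfolding bary_subdivision_def using finite_complex finite_subset by blast
next
  fix S assume "S \<in> simplices (bary_subdivision L)"
  then obtain C where C: "C \<in> Chains (face_poset L)" "C \<noteq> {}" "S = chain_simplex C"
    unfolding simplices_bary_subdivision by blast
  have vS: "verts S = barycenter ` C" using verts_chain_simplex C by simp
  show "finite (verts S)" using vS finite_chain_image C by simp
  show "convex hull verts S = S" using vS C by (simp add: chain_simplex_def)
  fix V assume "V \<subseteq> verts S"
  then obtain D where D: "D \<subseteq> C" "V = barycenter ` D" using vS by (metis subset_image_iff)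
  have "D \<in> Chains (face_poset L)"
    using C(1) D(1) nested_subset unfolding Chains_face_poset by blast
  then show "verts (convex hull V) = V"
    and "V \<noteq> {} \<Longrightarrow> convex hull V \<in> simplices (bary_subdivision L)"
    using verts_chain_simplex D(2) unfolding simplices_bary_subdivision chain_simplex_def by auto
next
  fix S T c d x
  assume "S \<in> simplices (bary_subdivision L)" "T \<in> simplices (bary_subdivision L)"
    and c: "bary_coords (verts S) c x" and d: "bary_coords (verts T) d x"
  then obtain C D where C: "C \<in> Chains (face_poset L)" "S = chain_simplex C"
    and D: "D \<in> Chains (face_poset L)" "T = chain_simplex D"
    unfolding simplices_bary_subdivision by blast
  show "c = d"
    by (rule chain_coords_unique[OF C(1) _ D(1)])
      (use c d C D in \<open>simp_all add: verts_chain_simplex\<close>)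
qed

lemma chain_simplex_subset_Union:
  assumes "C \<in> Chains (face_poset L)" "C \<noteq> {}"
  shows "chain_simplex C \<subseteq> \<Union>C"
proof -
  have T: "\<Union>C \<in> simplices L" using chain_Union(1)[OF assms] chain_subset[OF assms(1)] by blast
  have "barycenter ` C \<subseteq> \<Union>C" using barycenter_in chain_subset[OF assms(1)] by blast
  moreover have "convex (\<Union>C)" using convex_convex_hull[of "verts (\<Union>C)"] unfolding hull_verts[OF T] .
  ultimately show ?thesis unfolding chain_simplex_def by (rule hull_minimal)
qed

text \<open>
  For the inclusion from right to left, the layer cake decomposition of the coordinates of a point
  exhibits it as a convex combination of barycenters of a chain of faces.
\<close>

lemma Union_bary_subdivision: "\<Union>(bary_subdivision L) = \<Union>L"
proof
  show "\<Union>(bary_subdivision L) \<subseteq> \<Union>L"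
  proof
    fix x assume "x \<in> \<Union>(bary_subdivision L)"
    then have "x \<in> \<Union>(simplices (bary_subdivision L))" by (simp only: Union_simplices)
    then obtain C where C: "C \<in> Chains (face_poset L)" "C \<noteq> {}" "x \<in> chain_simplex C"
      unfolding simplices_bary_subdivision by auto
    have "x \<in> \<Union>C" using chain_simplex_subset_Union[OF C(1,2)] C(3) by blast
    then show "x \<in> \<Union>L" using chain_subset[OF C(1)] Union_simplices[of L] by blast
  qed
next
  show "\<Union>L \<subseteq> \<Union>(bary_subdivision L)"
  proof
    fix x assume "x \<in> \<Union>L"
    then obtain S where S: "S \<in> simplices L" "x \<in> S" using Union_simplices by blast
    let ?c = "coords L x"
    have c: "bary_coords (verts S) ?c x" by (rule bary_coords_coords[OF S])
    note supp = bary_coords_support[OF c finite_verts[OF S(1)]]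
    have "\<exists>\<V> \<mu>. finite \<V> \<and> nested (\<lambda>V. V) \<V> \<and> (\<forall>V\<in>\<V>. V \<noteq> {} \<and> V \<subseteq> {v. 0 < ?c v} \<and> 0 < \<mu> V) \<and>
        layer_sum (\<lambda>V. V) \<V> \<mu> = ?c"
      by (rule layer_cake) (use finite_subset[OF supp(1) finite_verts[OF S(1)]] c in \<open>auto simp: bary_coords_def\<close>)
    then obtain \<V> \<mu> where V: "finite \<V>" "nested (\<lambda>V. V) \<V>"
      "\<And>V. V \<in> \<V> \<Longrightarrow> V \<noteq> {} \<and> V \<subseteq> {v. 0 < ?c v} \<and> 0 < \<mu> V" "layer_sum (\<lambda>V. V) \<V> \<mu> = ?c"
      by auto
    have VS: "V \<noteq> {}" "V \<subseteq> verts S" "finite V" "0 \<le> \<mu> V" if "V \<in> \<V>" for V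
      using V(3)[OF that] order_trans[OF _ supp(1), of V] finite_subset[OF _ finite_verts[OF S(1)], of V] by auto
    define C where "C = (\<lambda>V. convex hull V) ` \<V>"
    have inj: "inj_on (\<lambda>V. convex hull V) \<V>" using verts_hull[OF S(1)] VS(2) by (metis inj_onI)
    have C: "C \<in> Chains (face_poset L)"
      unfolding Chains_face_poset
    proof
      show "C \<subseteq> simplices L" using face_closed[OF S(1)] VS unfolding C_def by blast
      show "nested (\<lambda>S. S) C"
      proof -
        have "convex hull V \<subseteq> convex hull W \<or> convex hull W \<subseteq> convex hull V" if "V \<in> \<V>" "W \<in> \<V>" for V W
          using nestedD[OF V(2) that] hull_mono[of V W convex] hull_mono[of W V convex] by blast
        then show ?thesis unfolding nested_def C_def by blast
      qed
    qed
    have swap: "(\<Sum>u\<in>verts S. ?c u *\<^sub>R g u) = (\<Sum>V\<in>\<V>. \<mu> V *\<^sub>R (\<Sum>u\<in>V. g u))"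
      for g :: "'a \<Rightarrow> 'b::real_vector"
    proof -
      have "(\<Sum>u\<in>verts S. ?c u *\<^sub>R g u) =
          (\<Sum>V\<in>\<V>. \<Sum>u\<in>verts S. (if u \<in> V then \<mu> V else 0) *\<^sub>R g u)"
        unfolding V(4)[symmetric] layer_sum_def scaleR_left.sum by (rule sum.swap)
      also have "\<dots> = (\<Sum>V\<in>\<V>. \<Sum>u\<in>V. \<mu> V *\<^sub>R g u)"
        using VS finite_verts[OF S(1)] by (intro sum.cong refl sum.mono_neutral_cong_right) auto
      finally show ?thesis by (simp add: scaleR_right.sum)
    qed
    \<comment> \<open>Layer weights count each vertex; multiplied by the size of the layer they are weights of barycenters.\<close>
    define \<nu> where "\<nu> = (\<lambda>V. \<mu> V * real (card V))"
    have "(\<Sum>V\<in>\<V>. \<nu> V) = 1"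
      using swap[of "\<lambda>_. 1::real"] c unfolding \<nu>_def bary_coords_def by simp
    moreover have "(\<Sum>V\<in>\<V>. \<nu> V *\<^sub>R barycenter (convex hull V)) = x"
    proof -
      have "\<nu> V *\<^sub>R barycenter (convex hull V) = \<mu> V *\<^sub>R (\<Sum>u\<in>V. u)" if "V \<in> \<V>" for V
        using VS[OF that] verts_hull[OF S(1), of V] by (simp add: barycenter_def \<nu>_def)
      then show ?thesis using swap[of "\<lambda>u. u"] c unfolding bary_coords_def by simp
    qed
    moreover have "barycenter (convex hull V) \<in> chain_simplex C" if "V \<in> \<V>" for V
      unfolding chain_simplex_def C_def using that by (intro hull_inc) auto
    moreover have "0 \<le> \<nu> V" if "V \<in> \<V>" for V using VS(4)[OF that] by (simp add: \<nu>_def)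
    ultimately have "x \<in> chain_simplex C"
      using convex_sum[OF V(1), of "chain_simplex C" \<nu> "\<lambda>V. barycenter (convex hull V)"]
      by (simp add: chain_simplex_def)
    then show "x \<in> \<Union>(bary_subdivision L)" using C unfolding bary_subdivision_def by blast
  qed
qed

text \<open>
  The largest simplex of the chain that spans the carrier in the subdivision is the carrier in the
  original complex.  Since the natural map takes the maximum of a chain, it sends carriers
  to carriers.
\<close>

lemma carrier_bary_subdivision:
  assumes x: "x \<in> \<Union>L"
  obtains C where "C \<in> Chains (face_poset L)" "C \<noteq> {}"
    "carrier (bary_subdivision L) x = chain_simplex C" "\<Union>C = carrier L x"
proof -
  interpret sub: geometric_complex "bary_subdivision L" by (rule geometric_complex_bary_subdivision)
  obtain S where S: "S \<in> simplices (bary_subdivision L)" "x \<in> S"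
    using x Union_bary_subdivision Union_simplices by blast
  then obtain D where D: "D \<in> Chains (face_poset L)" "S = chain_simplex D"
    unfolding simplices_bary_subdivision by blast
  let ?c = "coords (bary_subdivision L) x"
  define C where "C = {S \<in> D. 0 < ?c (barycenter S)}"
  have c: "bary_coords (barycenter ` D) ?c x"
    using sub.bary_coords_coords[OF S] verts_chain_simplex D by simp
  note P = coords_chain_point[OF D(1) c, folded C_def]
  have "\<Union>C \<in> simplices L" using chain_Union(1)[OF P(1,2)] chain_subset[OF P(1)] by blast
  then have "carrier L x = \<Union>C" unfolding carrier_def P(5) by (rule hull_verts)
  moreover have "carrier (bary_subdivision L) x = chain_simplex C"
    unfolding carrier_def chain_simplex_def P(3) ..
  ultimately show thesis using that P(1,2) by simp
qed

lemma inj_on_chain_simplex: "inj_on chain_simplex (Chains (face_poset L))"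
proof (rule inj_onI)
  fix C D assume C: "C \<in> Chains (face_poset L)" and D: "D \<in> Chains (face_poset L)"
    and "chain_simplex C = chain_simplex D"
  then have "barycenter ` C = barycenter ` D" using verts_chain_simplex by metis
  then show "C = D" using inj_on_image_eq_iff[OF inj_on_barycenter] chain_subset C D by metis
qed

lemma chain_simplex_subset_iff:
  assumes C: "C \<in> Chains (face_poset L)" "C \<noteq> {}" and D: "D \<in> Chains (face_poset L)" "D \<noteq> {}"
  shows "chain_simplex C \<subseteq> chain_simplex D \<longleftrightarrow> C \<subseteq> D"
proof -
  interpret sub: geometric_complex "bary_subdivision L" by (rule geometric_complex_bary_subdivision)
  have "chain_simplex C \<subseteq> chain_simplex D \<longleftrightarrow> barycenter ` C \<subseteq> barycenter ` D"
    using sub.simplex_subset_iff[of "chain_simplex C" "chain_simplex D"] C D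
    by (simp add: simplices_bary_subdivision verts_chain_simplex)
  also have "\<dots> \<longleftrightarrow> C \<subseteq> D"
    using inj_on_image_subset_iff[OF inj_on_barycenter] chain_subset C D by metis
  finally show ?thesis .
qed

text \<open>
  Subdividing does not raise the dimension of the carrier of a point: a strictly increasing chain of
  vertex sets has at most as many members as its top has elements.
\<close>

lemma card_chain_le:
  assumes C: "C \<in> Chains (face_poset L)" "C \<noteq> {}"
  shows "card C \<le> card (verts (\<Union>C))"
proof -
  note sub = chain_subset[OF C(1)]
  have fT: "finite (verts (\<Union>C))" using chain_Union(1)[OF C] sub finite_verts by blast
  have inj: "inj_on (\<lambda>S. card (verts S)) C"
  proof (rule inj_onI)
    fix S T assume S: "S \<in> C" and T: "T \<in> C" and eq: "card (verts S) = card (verts T)"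
    have "finite (verts S)" "finite (verts T)" using S T sub finite_verts by blast+
    then have "verts S = verts T"
      using nestedD[OF nested_verts[OF C(1)] S T] eq card_subset_eq by metis
    then show "S = T" using inj_onD[OF inj_on_verts] S T sub by blast
  qed
  have "(\<lambda>S. card (verts S)) ` C \<subseteq> {1..card (verts (\<Union>C))}"
  proof
    fix k assume "k \<in> (\<lambda>S. card (verts S)) ` C"
    then obtain S where S: "S \<in> C" "k = card (verts S)" by blast
    have "k \<noteq> 0" using S card_verts_pos[OF subsetD[OF sub S(1)]] by simp
    moreover have "k \<le> card (verts (\<Union>C))"
      using S chain_Union(2)[OF C] card_mono[OF fT] by blast
    ultimately show "k \<in> {1..card (verts (\<Union>C))}" by simp
  qed
  from card_inj_on_le[OF inj this] show ?thesis by simp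
qed

end

section \<open>Mesh of the subdivision\<close>

context geometric_complex
begin

lemma card_verts_le:
  assumes "S \<in> simplices L"
  shows "card (verts S) \<le> DIM('a) + 1"
proof (rule ccontr)
  assume "\<not> card (verts S) \<le> DIM('a) + 1"
  then have "affine_dependent (verts S)"
    using affine_dependent_biggerset[OF finite_verts[OF assms]] by simp
  then show False
    using affine_dependent_iff_coords_not_unique[OF finite_verts[OF assms]] coords_unique[OF assms assms] by blast
qed

text \<open>
  For a vertex \<open>v\<close> of a simplex with \<open>n\<close> vertices, \<open>v - barycenter S\<close> is the average of
  the \<open>n\<close> differences \<open>v - w\<close>, one of which is zero.  This gives the factor \<open>(n - 1) / n\<close>,
  and \<open>n\<close> is at most the dimension of the space plus one.  Balls are convex, so the bound passes
  from the vertices to the simplex.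
\<close>

lemma dist_barycenter_le:
  assumes S: "S \<in> simplices L" and d: "\<And>x y. x \<in> S \<Longrightarrow> y \<in> S \<Longrightarrow> dist x y \<le> d" and "x \<in> S"
  shows "dist x (barycenter S) \<le> real DIM('a) / (real DIM('a) + 1) * d"
proof -
  let ?V = "verts S" and ?n = "real (card (verts S))" and ?D = "real DIM('a)"
  have n: "0 < ?n" "?n \<le> ?D + 1" using card_verts_pos[OF S] card_verts_le[OF S] by simp_all
  have d0: "0 \<le> d" using d[OF \<open>x \<in> S\<close> \<open>x \<in> S\<close>] by simp
  have "dist v (barycenter S) \<le> ?D / (?D + 1) * d" if v: "v \<in> ?V" for v
  proof -
    have "?n *\<^sub>R (v - barycenter S) = (\<Sum>w\<in>?V. v - w)"
      using n by (simp add: barycenter_def scaleR_diff_right sum_subtractf sum_constant_scaleR)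
    also have "\<dots> = (\<Sum>w\<in>?V - {v}. v - w)"
      using finite_verts[OF S] by (subst sum.remove[OF _ v]) auto
    finally have "?n * dist v (barycenter S) = norm (\<Sum>w\<in>?V - {v}. v - w)"
      unfolding dist_norm using n(1) by (metis abs_of_pos norm_scaleR)
    also have "\<dots> \<le> (\<Sum>w\<in>?V - {v}. d)"
      by (rule sum_norm_le) (use d v verts_subset[OF S] in \<open>auto simp: dist_norm[symmetric]\<close>)
    also have "\<dots> = (?n - 1) * d"
      using v finite_verts[OF S] card_verts_pos[OF S] by (simp add: of_nat_diff)
    finally have "dist v (barycenter S) \<le> (?n - 1) / ?n * d" using n by (simp add: field_simps)
    also have "(?n - 1) / ?n \<le> ?D / (?D + 1)" using n by (simp add: field_simps)
    then have "(?n - 1) / ?n * d \<le> ?D / (?D + 1) * d" using d0 by (rule mult_right_mono)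
    finally show ?thesis .
  qed
  then have "?V \<subseteq> cball (barycenter S) (?D / (?D + 1) * d)" by (auto simp: dist_commute)
  then have "convex hull ?V \<subseteq> cball (barycenter S) (?D / (?D + 1) * d)"
    using convex_cball by (rule hull_minimal)
  then show ?thesis using \<open>x \<in> S\<close> hull_verts[OF S] by (auto simp: dist_commute)
qed

lemma mesh_bary_subdivision:
  assumes d: "\<And>S x y. S \<in> simplices L \<Longrightarrow> x \<in> S \<Longrightarrow> y \<in> S \<Longrightarrow> dist x y \<le> d"
    and S: "S \<in> simplices (bary_subdivision L)" and xy: "x \<in> S" "y \<in> S"
  shows "dist x y \<le> real DIM('a) / (real DIM('a) + 1) * d"
proof -
  let ?r = "real DIM('a) / (real DIM('a) + 1) * d"
  obtain C where C: "C \<in> Chains (face_poset L)" "S = chain_simplex C"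
    using S unfolding simplices_bary_subdivision by blast
  note sub = chain_subset[OF C(1)]
  have ordered: "dist (barycenter A) (barycenter B) \<le> ?r"
    if "A \<in> simplices L" "B \<in> simplices L" "A \<subseteq> B" for A B
    by (rule dist_barycenter_le[OF that(2)]) (use d that barycenter_in in auto)
  have "dist (barycenter A) (barycenter B) \<le> ?r" if "A \<in> C" "B \<in> C" for A B
    using ordered[of A B] ordered[of B A] C(1) sub that
    unfolding Chains_face_poset nested_def by (metis dist_commute subsetD)
  then have "barycenter ` C \<subseteq> cball (barycenter A) ?r" if "A \<in> C" for A using that by auto
  then have S_ball: "S \<subseteq> cball (barycenter A) ?r" if "A \<in> C" for A
    unfolding C(2) chain_simplex_def using that by (intro hull_minimal) auto
  have "dist x (barycenter A) \<le> ?r" if "A \<in> C" for A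
    using subsetD[OF S_ball[OF that] xy(1)] by (simp add: dist_commute)
  then have "barycenter ` C \<subseteq> cball x ?r" by auto
  then have "S \<subseteq> cball x ?r"
    unfolding C(2) chain_simplex_def by (intro hull_minimal) auto
  then show ?thesis using xy(2) by auto
qed

section \<open>Open stars\<close>

lemma compact_Union: "compact (\<Union>L)"
proof -
  have "compact S" if "S \<in> simplices L" for S
    using hull_verts[OF that] finite_verts[OF that] finite_imp_compact_convex_hull by metis
  moreover have "finite (simplices L)" using finite_complex unfolding simplices_def by simp
  ultimately show ?thesis using compact_Union[of "simplices L"] unfolding Union_simplices by blast
qed

text \<open>
  The complement of the open star of \<open>w\<close> is the union of the simplices without the vertex
  \<open>w\<close>, a finite union of closed sets.
\<close>

lemma openin_open_star: "openin (top_of_set (\<Union>L)) {x \<in> \<Union>L. 0 < coords L x w}"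
proof -
  let ?F = "{S \<in> simplices L. w \<notin> verts S}"
  have "closed S" if "S \<in> simplices L" for S
    using hull_verts[OF that] finite_verts[OF that] finite_imp_compact_convex_hull compact_imp_closed by metis
  moreover have "finite ?F" using finite_complex unfolding simplices_def by simp
  ultimately have "closed (\<Union>?F)" by (intro closed_Union) auto
  moreover have "{x \<in> \<Union>L. 0 < coords L x w} = \<Union>L - \<Union>?F"
  proof (intro subset_antisym subsetI)
    fix x assume x: "x \<in> {x \<in> \<Union>L. 0 < coords L x w}"
    then have "w \<in> verts S" if "S \<in> simplices L" "x \<in> S" for S
      using coords_support_subset[OF that] by blast
    then show "x \<in> \<Union>L - \<Union>?F" using x by blast
  next
    fix x assume x: "x \<in> \<Union>L - \<Union>?F"
    then have "w \<in> verts (carrier L x)" using carrier_in in_carrier by blast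
    then show "x \<in> {x \<in> \<Union>L. 0 < coords L x w}" using x verts_carrier by blast
  qed
  ultimately show ?thesis using openin_diff[OF openin_subtopology_self] closed_subset
    by (simp add: Diff_eq open_Compl openin_open_Int)
qed

lemma openin_vimage_open_star:
  assumes "continuous_on (\<Union>L) f" "f ` (\<Union>L) \<subseteq> \<Union>L"
  shows "openin (top_of_set (\<Union>L)) {x \<in> \<Union>L. 0 < coords L (f x) w}"
proof -
  have "openin (top_of_set (\<Union>L)) (\<Union>L \<inter> f -` {x \<in> \<Union>L. 0 < coords L x w})"
    using continuous_openin_preimage[OF assms(1) _ openin_open_star] assms(2) by blast
  moreover have "\<Union>L \<inter> f -` {x \<in> \<Union>L. 0 < coords L x w} = {x \<in> \<Union>L. 0 < coords L (f x) w}"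
    using assms(2) by blast
  ultimately show ?thesis by simp
qed

text \<open>
  The preimages under \<open>f\<close> of the open stars of the vertices cover the compact polyhedron;
  \<open>e\<close> is a Lebesgue number of this cover.
\<close>

lemma open_star_Lebesgue_number:
  assumes f: "continuous_on (\<Union>L) f" "f ` (\<Union>L) \<subseteq> \<Union>L"
  obtains e where "0 < e"
    "\<And>x. x \<in> \<Union>L \<Longrightarrow> \<exists>w. \<forall>y\<in>\<Union>L. dist x y < e \<longrightarrow> 0 < coords L (f y) w"
proof -
  have "\<exists>U. open U \<and> {x \<in> \<Union>L. 0 < coords L (f x) w} = \<Union>L \<inter> U" for w
    using openin_vimage_open_star[OF f, of w] unfolding openin_open .
  then obtain U where U: "\<And>w. open (U w)" "\<And>w. {x \<in> \<Union>L. 0 < coords L (f x) w} = \<Union>L \<inter> U w"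
    by metis
  have "\<Union>L \<subseteq> \<Union>(range U)"
  proof
    fix x assume x: "x \<in> \<Union>L"
    then have fx: "f x \<in> \<Union>L" using f(2) by blast
    obtain w where "w \<in> verts (carrier L (f x))" using verts_nonempty[OF carrier_in[OF fx]] by blast
    then have "x \<in> U w" using verts_carrier[OF fx] U(2)[of w] x by blast
    then show "x \<in> \<Union>(range U)" by blast
  qed
  then obtain e where e: "0 < e" "\<And>x. x \<in> \<Union>L \<Longrightarrow> \<exists>G\<in>range U. ball x e \<subseteq> G"
    using Heine_Borel_lemma[OF compact_Union, of "range U"] U(1) by blast
  show thesis
  proof (rule that[OF e(1)])
    fix x assume "x \<in> \<Union>L"
    then obtain w where "ball x e \<subseteq> U w" using e(2) by blast
    have "0 < coords L (f y) w" if "y \<in> \<Union>L" "dist x y < e" for y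
    proof -
      have "y \<in> \<Union>L \<inter> U w" using that \<open>ball x e \<subseteq> U w\<close> by auto
      then show ?thesis unfolding U(2)[symmetric] by simp
    qed
    then show "\<exists>w. \<forall>y\<in>\<Union>L. dist x y < e \<longrightarrow> 0 < coords L (f y) w" by blast
  qed
qed

text \<open>
  Near \<open>p\<close> all vertices of the carrier of \<open>f p\<close> are admissible values of a vertex map at
  once.  When \<open>p\<close> is a fixed point, this is the freedom that allows a simplicial approximation
  to map the carrier of \<open>p\<close> onto a carrier of \<open>p\<close>.
\<close>

lemma carrier_star_neighbourhood:
  assumes f: "continuous_on (\<Union>L) f" "f ` (\<Union>L) \<subseteq> \<Union>L" and p: "p \<in> \<Union>L"
  obtains e where "0 < e"
    "\<And>y w. y \<in> \<Union>L \<Longrightarrow> dist p y < e \<Longrightarrow> w \<in> verts (carrier L (f p)) \<Longrightarrow> 0 < coords L (f y) w"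
proof -
  have fp: "f p \<in> \<Union>L" using f(2) p by blast
  let ?W = "verts (carrier L (f p))"
  have "openin (top_of_set (\<Union>L)) (\<Inter>w\<in>?W. {x \<in> \<Union>L. 0 < coords L (f x) w})"
    using finite_verts[OF carrier_in[OF fp]] verts_nonempty[OF carrier_in[OF fp]] openin_vimage_open_star[OF f]
    by (intro openin_Inter) auto
  moreover have "p \<in> (\<Inter>w\<in>?W. {x \<in> \<Union>L. 0 < coords L (f x) w})"
    using verts_carrier[OF fp] p by auto
  ultimately obtain e where "0 < e" "ball p e \<inter> \<Union>L \<subseteq> (\<Inter>w\<in>?W. {x \<in> \<Union>L. 0 < coords L (f x) w})"
    unfolding openin_contains_ball by blast
  then show thesis by (intro that[of e]) auto
qed

end

section \<open>Simplicial approximation\<close>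

text \<open>
  The sum ranges over all vertices of the complex, so that no simplex containing the point has to
  be chosen; the coordinates at vertices off such a simplex vanish.
\<close>

definition simplicial_extension ::
    "'a::euclidean_space set set \<Rightarrow> ('a \<Rightarrow> 'a) \<Rightarrow> 'a \<Rightarrow> 'a" where
  "simplicial_extension M w x = (\<Sum>v\<in>\<Union>(verts ` simplices M). coords M x v *\<^sub>R w v)"

text \<open>
  The vertex maps that define simplicial approximations of \<open>f\<close>: the image under \<open>f\<close> of the
  closed star of each vertex \<open>v\<close> lies in the open star of \<open>w v\<close>.
\<close>

locale star_vertex_map =
  M: geometric_complex M + L: geometric_complex L
  for M L :: "'a::euclidean_space set set" +
  fixes f w :: "'a \<Rightarrow> 'a"
  assumes f_maps: "f ` \<Union>M \<subseteq> \<Union>L"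
    and star: "S \<in> simplices M \<Longrightarrow> v \<in> verts S \<Longrightarrow> x \<in> S \<Longrightarrow> 0 < coords L (f x) (w v)"
begin

abbreviation g where "g \<equiv> simplicial_extension M w"

lemma g_eq:
  assumes "S \<in> simplices M" "x \<in> S"
  shows "g x = (\<Sum>v\<in>verts S. coords M x v *\<^sub>R w v)"
  unfolding simplicial_extension_def
proof (rule sum.mono_neutral_right)
  have "finite (simplices M)" using M.finite_complex unfolding simplices_def by simp
  then show "finite (\<Union>(verts ` simplices M))" using M.finite_verts by blast
  show "verts S \<subseteq> \<Union>(verts ` simplices M)" using assms by blast
  show "\<forall>v\<in>\<Union>(verts ` simplices M) - verts S. coords M x v *\<^sub>R w v = 0"
    using M.bary_coords_coords[OF assms] unfolding bary_coords_def by simp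
qed

lemma g_vertex:
  assumes S: "S \<in> simplices M" "v \<in> verts S"
  shows "g v = w v"
proof -
  have "coords M v = (\<lambda>u. if u = v then 1 else 0)"
    using M.coords_eq[OF S(1)] bary_coords_vertex[OF M.finite_verts[OF S(1)] S(2)] by blast
  moreover have "v \<in> S" using M.verts_subset S by blast
  moreover have "(\<Sum>u\<in>verts S. (if u = v then 1 else 0) *\<^sub>R w u) = (\<Sum>u\<in>verts S. if u = v then w u else 0)"
    by (intro sum.cong) auto
  ultimately show ?thesis using g_eq[OF S(1)] S(2) M.finite_verts[OF S(1)] by simp
qed

lemma convex_simplex: "S \<in> simplices M \<Longrightarrow> convex S"
  using M.hull_verts convex_convex_hull by metis

lemma g_affine:
  assumes S: "S \<in> simplices M" and x: "x \<in> S" and y: "y \<in> S" and t: "t \<in> {0..1}"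
  shows "g ((1 - t) *\<^sub>R x + t *\<^sub>R y) = (1 - t) *\<^sub>R g x + t *\<^sub>R g y"
proof -
  let ?z = "(1 - t) *\<^sub>R x + t *\<^sub>R y"
  have "?z \<in> S" using convexD[OF convex_simplex[OF S] x y, of "1 - t" t] t by auto
  moreover have "coords M ?z = (\<lambda>v. (1 - t) * coords M x v + t * coords M y v)"
    using M.coords_eq[OF S] bary_coords_affine M.bary_coords_coords[OF S] x y t by blast
  ultimately have "g ?z = (\<Sum>v\<in>verts S. ((1 - t) * coords M x v + t * coords M y v) *\<^sub>R w v)"
    using g_eq[OF S] by simp
  also have "\<dots> = (1 - t) *\<^sub>R (\<Sum>v\<in>verts S. coords M x v *\<^sub>R w v) + t *\<^sub>R (\<Sum>v\<in>verts S. coords M y v *\<^sub>R w v)"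
    by (simp only: scaleR_left_distrib sum.distrib scaleR_right.sum scaleR_scaleR)
  finally show ?thesis using g_eq[OF S] x y by simp
qed

lemma g_image:
  assumes S: "S \<in> simplices M"
  shows "g ` S = convex hull (w ` verts S)"
proof
  show "g ` S \<subseteq> convex hull (w ` verts S)"
  proof
    fix y assume "y \<in> g ` S"
    then obtain x where x: "x \<in> S" "y = g x" by blast
    have "(\<Sum>v\<in>verts S. coords M x v *\<^sub>R w v) \<in> convex hull (w ` verts S)"
      using M.bary_coords_coords[OF S x(1)] M.finite_verts[OF S]
      unfolding bary_coords_def by (intro convex_sum convex_convex_hull) (simp_all add: hull_inc)
    then show "y \<in> convex hull (w ` verts S)" using g_eq[OF S x(1)] x(2) by simp
  qed
  have "w ` verts S \<subseteq> g ` S"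
  proof
    fix y assume "y \<in> w ` verts S"
    then obtain v where v: "v \<in> verts S" "y = g v" using g_vertex[OF S] by auto
    then show "y \<in> g ` S" using M.verts_subset[OF S] by blast
  qed
  moreover have "convex (g ` S)"
    unfolding convex_alt
  proof (intro ballI allI impI)
    fix a b :: 'a and t :: real assume "a \<in> g ` S" "b \<in> g ` S" and t: "0 \<le> t \<and> t \<le> 1"
    then obtain x y where xy: "x \<in> S" "y \<in> S" "a = g x" "b = g y" by blast
    have "(1 - t) *\<^sub>R x + t *\<^sub>R y \<in> S" using convexD[OF convex_simplex[OF S] xy(1,2), of "1 - t" t] t by auto
    then show "(1 - t) *\<^sub>R a + t *\<^sub>R b \<in> g ` S" using g_affine[OF S xy(1,2), of t, symmetric] t xy(3,4) by simp
  qed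
  ultimately show "convex hull (w ` verts S) \<subseteq> g ` S" by (rule hull_minimal)
qed

text \<open>
  A point \<open>f x\<close> in the open stars of several vertices has all of them as vertices of its carrier.
  Hence the images of the vertices of \<open>S\<close> span a face of that carrier, which makes the extension
  simplicial and simplicially close to \<open>f\<close>.
\<close>

lemma image_verts_subset_carrier:
  assumes "S \<in> simplices M" "x \<in> S"
  shows "w ` verts S \<subseteq> verts (carrier L (f x))" "carrier L (f x) \<in> simplices L" "f x \<in> carrier L (f x)"
proof -
  have fx: "f x \<in> \<Union>L" using assms f_maps Union_simplices[of M] by blast
  show "carrier L (f x) \<in> simplices L" "f x \<in> carrier L (f x)" using L.carrier_in L.in_carrier fx by auto
  show "w ` verts S \<subseteq> verts (carrier L (f x))" using star assms L.verts_carrier[OF fx] by blast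
qed

lemma simplicial_map_g: "simplicial_map M L g"
  unfolding simplicial_map_def
proof (intro ballI conjI)
  fix S assume S: "S \<in> simplices M"
  then obtain x where x: "x \<in> S" unfolding simplices_def by blast
  note car = image_verts_subset_carrier[OF S x]
  have "g ` verts S = w ` verts S" using g_vertex[OF S] by simp
  then show "\<exists>T\<in>simplices L. g ` verts S = verts T"
    using L.face_closed[OF car(2,1)] L.verts_hull[OF car(2,1)] M.verts_nonempty[OF S]
    by (intro bexI[of _ "convex hull (w ` verts S)"]) auto
qed (rule g_affine)

lemma simplicially_close_g: "simplicially_close M L g f"
  unfolding simplicially_close_def
proof
  fix x assume "x \<in> \<Union>M"
  then obtain S where S: "S \<in> simplices M" "x \<in> S" using Union_simplices by blast
  note car = image_verts_subset_carrier[OF S]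
  have "g x \<in> convex hull (w ` verts S)" using g_image[OF S(1)] S(2) by blast
  also have "\<dots> \<subseteq> convex hull verts (carrier L (f x))" using car(1) by (rule hull_mono)
  also have "\<dots> = carrier L (f x)" by (rule L.hull_verts[OF car(2)])
  finally show "\<exists>T\<in>simplices L. g x \<in> T \<and> f x \<in> T" using car by blast
qed

end

lemma ex_surjection:
  assumes "finite A" "finite B" "B \<noteq> {}" "card B \<le> card A"
  obtains r where "r ` A = B"
proof -
  obtain h where h: "h ` B \<subseteq> A" "inj_on h B"
    using card_le_inj[OF assms(2,1,4)] by blast
  obtain b where b: "b \<in> B" using assms(3) by blast
  have "(\<lambda>a. if a \<in> h ` B then inv_into B h a else b) ` A = B"
  proof (intro subset_antisym subsetI)
    fix y assume "y \<in> B"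
    then show "y \<in> (\<lambda>a. if a \<in> h ` B then inv_into B h a else b) ` A"
      using h by (intro image_eqI[of _ _ "h y"]) auto
  qed (use b in \<open>auto simp: inv_into_into\<close>)
  then show thesis by (rule that)
qed

text \<open>
  The simplicial approximation theorem with one extra demand at a fixed point \<open>p\<close>.  The vertices
  of the carrier of \<open>p\<close> in a fine complex \<open>M\<close> are so close to \<open>p\<close> that they may be sent to any
  vertices of the carrier of \<open>p\<close> in \<open>L\<close>.  If there are enough of them, they are sent onto
  these vertices.
\<close>

lemma (in geometric_complex) ex_simplicial_approximation:
  assumes f: "continuous_on (\<Union>L) f" "f ` (\<Union>L) \<subseteq> \<Union>L" and p: "p \<in> \<Union>L" "f p = p"
  obtains e where "0 < e"
    "\<And>M. geometric_complex M \<Longrightarrow> \<Union>M = \<Union>L \<Longrightarrow>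
       (\<And>S x y. S \<in> simplices M \<Longrightarrow> x \<in> S \<Longrightarrow> y \<in> S \<Longrightarrow> dist x y < e) \<Longrightarrow>
       \<exists>g. simplicial_map M L g \<and> simplicially_close M L g f \<and>
         (card (verts (carrier L p)) \<le> card (verts (carrier M p)) \<longrightarrow> g ` carrier M p = carrier L p)"
proof -
  obtain e1 where e1: "0 < e1"
    "\<And>x. x \<in> \<Union>L \<Longrightarrow> \<exists>w. \<forall>y\<in>\<Union>L. dist x y < e1 \<longrightarrow> 0 < coords L (f y) w"
    using open_star_Lebesgue_number[OF f] by blast
  obtain e2 where e2: "0 < e2"
    "\<And>y w. y \<in> \<Union>L \<Longrightarrow> dist p y < e2 \<Longrightarrow> w \<in> verts (carrier L p) \<Longrightarrow> 0 < coords L (f y) w"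
    using carrier_star_neighbourhood[OF f p(1)] unfolding p(2) by blast
  from e1(2) obtain w where w: "\<And>x y. x \<in> \<Union>L \<Longrightarrow> y \<in> \<Union>L \<Longrightarrow> dist x y < e1 \<Longrightarrow> 0 < coords L (f y) (w x)"
    by metis
  show thesis
  proof (rule that[of "min e1 (e2 / 2)"])
    show "0 < min e1 (e2 / 2)" using e1 e2 by simp
    fix M assume M: "geometric_complex M" and same: "\<Union>M = \<Union>L"
      and mesh: "\<And>S x y. S \<in> simplices M \<Longrightarrow> x \<in> S \<Longrightarrow> y \<in> S \<Longrightarrow> dist x y < min e1 (e2 / 2)"
    interpret M: geometric_complex M by (rule M)
    let ?A = "verts (carrier M p)" and ?B = "verts (carrier L p)"
    have pM: "p \<in> \<Union>M" using p same by simp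
    note cM = M.carrier_in[OF pM] and cL = carrier_in[OF p(1)]
    have "\<exists>r. r ` ?A \<subseteq> ?B \<and> (card ?B \<le> card ?A \<longrightarrow> r ` ?A = ?B)"
    proof (cases "card ?B \<le> card ?A")
      case True
      then obtain r where "r ` ?A = ?B"
        using ex_surjection[OF M.finite_verts[OF cM] finite_verts[OF cL] verts_nonempty[OF cL]] by blast
      then show ?thesis by blast
    next
      case False
      obtain b where "b \<in> ?B" using verts_nonempty[OF cL] by blast
      then show ?thesis using False by (intro exI[of _ "\<lambda>_. b"]) auto
    qed
    then obtain r where r: "r ` ?A \<subseteq> ?B" "card ?B \<le> card ?A \<Longrightarrow> r ` ?A = ?B" by blast
    \<comment> \<open>The free choice near the fixed point, the Lebesgue number choice elsewhere.\<close>
    let ?w = "\<lambda>v. if v \<in> ?A then r v else w v"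
    interpret star_vertex_map M L f ?w
    proof unfold_locales
      show "f ` \<Union>M \<subseteq> \<Union>L" using f(2) same by simp
      fix S v x assume S: "S \<in> simplices M" and v: "v \<in> verts S" and x: "x \<in> S"
      have vS: "v \<in> S" using M.verts_subset[OF S] v by blast
      have X: "v \<in> \<Union>L" "x \<in> \<Union>L" using S vS x same Union_simplices[of M] by blast+
      show "0 < coords L (f x) (?w v)"
      proof (cases "v \<in> ?A")
        case True
        \<comment> \<open>The closed star of a vertex of the carrier reaches at most two mesh widths from \<open>p\<close>, whence \<open>e2 / 2\<close>.\<close>
        then have "dist p v < e2 / 2" "dist v x < e2 / 2"
          using mesh[OF cM M.in_carrier[OF pM], of v] M.verts_subset[OF cM] mesh[OF S vS x] by auto
        then have "dist p x < e2" using dist_triangle[of p x v] by linarith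
        then show ?thesis using e2(2) X(2) r(1) True by auto
      next
        case False
        then show ?thesis using w X mesh[OF S vS x] by auto
      qed
    qed
    have "?w ` ?A = r ` ?A" by simp
    then have "g ` carrier M p = carrier L p" if "card ?B \<le> card ?A"
      using g_image[OF cM] r(2)[OF that] hull_verts[OF cL] by simp
    then show "\<exists>g. simplicial_map M L g \<and> simplicially_close M L g f \<and>
         (card ?B \<le> card ?A \<longrightarrow> g ` carrier M p = carrier L p)"
      using simplicial_map_g simplicially_close_g by blast
  qed
qed

section \<open>Iterated subdivisions and natural maps\<close>

lemma iter_subdivision_0: "iter_subdivision K 0 = K"
  and iter_subdivision_Suc: "iter_subdivision K (Suc n) = bary_subdivision (iter_subdivision K n)"
  unfolding iter_subdivision_def by simp_all

lemma (in geometric_complex) finite_subdivision_face_poset: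
  assumes "Chains r = Chains (face_poset L)"
  shows "map_prod chain_simplex chain_simplex ` finite_subdivision r = face_poset (bary_subdivision L)"
proof -
  let ?C = "Chains (face_poset L) - {{}}"
  have "face_poset (bary_subdivision L) =
      {(S, T). S \<in> chain_simplex ` ?C \<and> T \<in> chain_simplex ` ?C \<and> S \<subseteq> T}"
    unfolding face_poset_def[of "bary_subdivision L"] simplices_bary_subdivision ..
  also have "\<dots> = map_prod chain_simplex chain_simplex ` {(C, D). C \<in> ?C \<and> D \<in> ?C \<and> C \<subseteq> D}"
  proof (intro subset_antisym subsetI)
    fix P assume "P \<in> {(S, T). S \<in> chain_simplex ` ?C \<and> T \<in> chain_simplex ` ?C \<and> S \<subseteq> T}"
    then obtain C D where CD: "C \<in> ?C" "D \<in> ?C" "P = (chain_simplex C, chain_simplex D)"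
      "chain_simplex C \<subseteq> chain_simplex D" by blast
    then have "C \<subseteq> D" using chain_simplex_subset_iff[of C D] by simp
    then show "P \<in> map_prod chain_simplex chain_simplex ` {(C, D). C \<in> ?C \<and> D \<in> ?C \<and> C \<subseteq> D}"
      using CD by (intro image_eqI[of _ _ "(C, D)"]) auto
  qed (use chain_simplex_subset_iff in auto)
  finally show ?thesis unfolding finite_subdivision_def assms ..
qed

lemma (in geometric_complex) chain_max_face_poset:
  assumes C: "C \<in> Chains (face_poset L)" "C \<noteq> {}"
  shows "chain_max (face_poset L) C = \<Union>C"
  unfolding chain_max_def
proof (rule the_equality)
  have "C \<subseteq> simplices L" "\<Union>C \<in> C" using chain_subset[OF C(1)] chain_Union(1)[OF C] by auto
  then show "\<Union>C \<in> C \<and> (\<forall>S\<in>C. (S, \<Union>C) \<in> face_poset L)"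
    unfolding face_poset_def by blast
  fix T assume "T \<in> C \<and> (\<forall>S\<in>C. (S, T) \<in> face_poset L)"
  then show "T = \<Union>C" unfolding face_poset_def by blast
qed

lemma Field_face_poset: "Field (face_poset L) = simplices L"
  unfolding Field_def face_poset_def by auto

context geometric_complex
begin

lemma geometric_complex_iter: "geometric_complex (iter_subdivision L n)"
  by (induction n)
    (auto simp: iter_subdivision_0 iter_subdivision_Suc geometric_complex_axioms
      intro: geometric_complex.geometric_complex_bary_subdivision)

lemma Union_iter: "\<Union>(iter_subdivision L n) = \<Union>L"
  by (induction n)
    (simp_all add: iter_subdivision_0 iter_subdivision_Suc
      geometric_complex.Union_bary_subdivision[OF geometric_complex_iter])

lemma mesh_iter_tendsto_0:
  assumes "0 < e"
  obtains N where "\<And>n S x y. N \<le> n \<Longrightarrow> S \<in> simplices (iter_subdivision L n) \<Longrightarrow> x \<in> S \<Longrightarrow> y \<in> S \<Longrightarrow> dist x y < e"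
proof -
  let ?q = "real DIM('a) / (real DIM('a) + 1)"
  obtain d where d: "\<And>x y. x \<in> \<Union>L \<Longrightarrow> y \<in> \<Union>L \<Longrightarrow> dist x y \<le> d"
    using compact_imp_bounded[OF compact_Union] bounded_two_points by metis
  have mesh: "dist x y \<le> ?q ^ n * d" if "S \<in> simplices (iter_subdivision L n)" "x \<in> S" "y \<in> S" for n S x y
    using that
  proof (induction n arbitrary: S x y)
    case 0
    then show ?case using d[of x y] Union_simplices[of L] by (auto simp: iter_subdivision_0)
  next
    case (Suc n)
    show ?case
      using geometric_complex.mesh_bary_subdivision[OF geometric_complex_iter Suc.IH
          Suc.prems(1)[unfolded iter_subdivision_Suc] Suc.prems(2,3)]
      by (simp add: mult.assoc)
  qed
  have "(\<lambda>n. ?q ^ n * d) \<longlonglongrightarrow> 0"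
    by (intro tendsto_mult_left_zero LIMSEQ_power_zero) simp
  then have "\<forall>\<^sub>F n in sequentially. ?q ^ n * d < e"
    using assms by (rule order_tendstoD(2))
  then obtain N where "\<And>n. N \<le> n \<Longrightarrow> ?q ^ n * d < e" unfolding eventually_sequentially by blast
  then show thesis using mesh that by (meson le_less_trans)
qed

text \<open>
  Passing to the opposite order does not change the chains, so the reversed order of the
  initial poset does not affect the later spaces: they are the face posets of the
  iterated subdivisions with their usual order.
\<close>

lemma Chains_fin_space_and_fin_space_Suc:
  "Chains (fin_space L n) = Chains (face_poset (iter_subdivision L n))"
  "fin_space L (Suc n) = face_poset (iter_subdivision L (Suc n))"
proof -
  have step: "fin_space L (Suc n) = face_poset (iter_subdivision L (Suc n))"
    if "Chains (fin_space L n) = Chains (face_poset (iter_subdivision L n))" for n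
    using geometric_complex.finite_subdivision_face_poset[OF geometric_complex_iter that]
    by (simp add: iter_subdivision_Suc)
  show *: "Chains (fin_space L n) = Chains (face_poset (iter_subdivision L n))" for n
  proof (induction n)
    case 0
    show ?case by (auto simp: iter_subdivision_0 Chains_def)
  next
    case (Suc n)
    then show ?case using step by simp
  qed
  show "fin_space L (Suc n) = face_poset (iter_subdivision L (Suc n))" by (rule step[OF *])
qed

lemma fin_space_eq_face_poset:
  assumes "0 < n"
  shows "fin_space L n = face_poset (iter_subdivision L n)"
  using assms Chains_fin_space_and_fin_space_Suc(2) by (cases n) auto

text \<open>
  At stage \<open>0\<close> the order is reversed and the natural map takes the smallest simplex of
  the chain instead.  This is why the lemmas on natural maps require \<open>0 < n\<close>.
\<close>

lemma natural_step_chain_simplex: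
  assumes "0 < n" and C: "C \<in> Chains (face_poset (iter_subdivision L n))" "C \<noteq> {}"
  shows "natural_step L n (chain_simplex C) = \<Union>C"
proof -
  interpret M: geometric_complex "iter_subdivision L n" by (rule geometric_complex_iter)
  have "inj_on chain_simplex (Chains (face_poset (iter_subdivision L n)) - {{}})"
    using M.inj_on_chain_simplex by (rule inj_on_subset) simp
  then have "the_inv_into (Chains (face_poset (iter_subdivision L n)) - {{}}) chain_simplex (chain_simplex C) = C"
    using C by (intro the_inv_into_f_f) auto
  then show ?thesis
    unfolding natural_step_def fin_space_eq_face_poset[OF assms(1)] by (simp add: M.chain_max_face_poset C)
qed

lemma subset_natural_step:
  assumes "0 < n" "S \<in> simplices (iter_subdivision L (Suc n))"
  shows "S \<subseteq> natural_step L n S" "natural_step L n S \<in> simplices (iter_subdivision L n)"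
proof -
  interpret M: geometric_complex "iter_subdivision L n" by (rule geometric_complex_iter)
  obtain C where C: "C \<in> Chains (face_poset (iter_subdivision L n))" "C \<noteq> {}" "S = chain_simplex C"
    using assms(2) unfolding iter_subdivision_Suc M.simplices_bary_subdivision by blast
  then have eq: "natural_step L n S = \<Union>C" using natural_step_chain_simplex assms(1) by simp
  show "S \<subseteq> natural_step L n S" using M.chain_simplex_subset_Union[OF C(1,2)] eq C(3) by simp
  show "natural_step L n S \<in> simplices (iter_subdivision L n)"
    using M.chain_Union(1)[OF C(1,2)] M.chain_subset[OF C(1)] eq by auto
qed

lemma subset_natural_steps:
  assumes "0 < n" "S \<in> simplices (iter_subdivision L (n + d))"
  shows "S \<subseteq> natural_steps L n d S \<and> natural_steps L n d S \<in> simplices (iter_subdivision L n)"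
  using assms(2)
proof (induction d arbitrary: S)
  case (Suc d)
  then have "S \<subseteq> natural_step L (n + d) S" "natural_step L (n + d) S \<in> simplices (iter_subdivision L (n + d))"
    using subset_natural_step[of "n + d" S] assms(1) by auto
  with Suc.IH show ?case by fastforce
qed simp

lemma subset_natural_map:
  assumes "0 < n" "n \<le> l" "S \<in> simplices (iter_subdivision L l)"
  shows "S \<subseteq> natural_map L n l S" "natural_map L n l S \<in> simplices (iter_subdivision L n)"
  using subset_natural_steps[of n S "l - n"] assms unfolding natural_map_def by auto

lemma natural_steps_carrier:
  assumes "0 < n" "x \<in> \<Union>L"
  shows "natural_steps L n d (carrier (iter_subdivision L (n + d)) x) = carrier (iter_subdivision L n) x"
proof (induction d)
  case (Suc d)
  interpret M: geometric_complex "iter_subdivision L (n + d)" by (rule geometric_complex_iter)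
  obtain C where C: "C \<in> Chains (face_poset (iter_subdivision L (n + d)))" "C \<noteq> {}"
    "carrier (iter_subdivision L (Suc (n + d))) x = chain_simplex C"
    "\<Union>C = carrier (iter_subdivision L (n + d)) x"
    using M.carrier_bary_subdivision[of x] assms(2) unfolding Union_iter iter_subdivision_Suc by blast
  then have "natural_step L (n + d) (carrier (iter_subdivision L (Suc (n + d))) x) =
      carrier (iter_subdivision L (n + d)) x"
    using natural_step_chain_simplex[of "n + d" C] assms(1) by simp
  with Suc.IH show ?case by simp
qed simp

text \<open>
  The carriers of one point form a thread of the inverse sequence from stage \<open>1\<close> on.
\<close>

lemma natural_map_carrier:
  assumes "0 < n" "n \<le> l" "x \<in> \<Union>L"
  shows "natural_map L n l (carrier (iter_subdivision L l) x) = carrier (iter_subdivision L n) x"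
  using natural_steps_carrier[of n x "l - n"] assms unfolding natural_map_def by simp

lemma card_verts_carrier_antimono:
  assumes "x \<in> \<Union>L" "n \<le> l"
  shows "card (verts (carrier (iter_subdivision L l) x)) \<le> card (verts (carrier (iter_subdivision L n) x))"
  using assms(2)
proof (induction l rule: dec_induct)
  case (step l)
  interpret M: geometric_complex "iter_subdivision L l" by (rule geometric_complex_iter)
  obtain C where C: "C \<in> Chains (face_poset (iter_subdivision L l))" "C \<noteq> {}"
    "carrier (iter_subdivision L (Suc l)) x = chain_simplex C"
    "\<Union>C = carrier (iter_subdivision L l) x"
    using M.carrier_bary_subdivision[of x] assms(1) unfolding Union_iter iter_subdivision_Suc by blast
  have "card (verts (carrier (iter_subdivision L (Suc l)) x)) = card C"
    unfolding C(3) M.verts_chain_simplex[OF C(1)] by (rule card_image[OF M.inj_on_barycenter_chain[OF C(1)]])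
  then show ?case using M.card_chain_le[OF C(1,2)] step.IH C(4) by simp
qed simp

text \<open>
  The dimensions of the carriers of a point do not increase, hence they are constant from some stage
  on.  From then on the vertices of a carrier can be mapped onto those of the carrier at an earlier stage.
\<close>

lemma card_verts_carrier_stabilizes:
  assumes "x \<in> \<Union>L"
  obtains N where "\<And>n l. N \<le> n \<Longrightarrow> n \<le> l \<Longrightarrow>
    card (verts (carrier (iter_subdivision L n) x)) \<le> card (verts (carrier (iter_subdivision L l) x))"
proof -
  let ?c = "\<lambda>n. card (verts (carrier (iter_subdivision L n) x))"
  obtain N where "\<And>n. ?c N \<le> ?c n" using ex_min_if_finite arg_min_nat_le[of "\<lambda>_. True" _ ?c] by blast
  then show thesis using card_verts_carrier_antimono[OF assms] that by (meson le_trans)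
qed

end

section \<open>Fixed points and coherent sequences\<close>

lemma fixed_point_from_approximate_fixed_points:
  fixes f :: "'a::metric_space \<Rightarrow> 'a"
  assumes X: "compact X" and f: "continuous_on X f"
    and approx: "\<And>e. 0 < e \<Longrightarrow> \<exists>x\<in>X. dist x (f x) \<le> e"
  shows "\<exists>x\<in>X. f x = x"
proof -
  have "X \<noteq> {}" using approx[of 1] by auto
  moreover have "continuous_on X (\<lambda>x. dist x (f x))" using f by (intro continuous_intros)
  ultimately obtain x where x: "x \<in> X" "\<And>y. y \<in> X \<Longrightarrow> dist x (f x) \<le> dist y (f y)"
    using continuous_attains_inf[OF X] by blast
  have "dist x (f x) \<le> e" if "0 < e" for e
    using approx[OF that] x(2) by (meson order_trans)
  then have "dist x (f x) \<le> 0" by (meson dense not_le order_less_irrefl)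
  then have "f x = x" by simp
  with x(1) show ?thesis by blast
qed

text \<open>
  Past the index \<open>m\<close>, the approximation \<open>g\<close> maps the simplex \<open>x (Suc n)\<close> onto \<open>x n\<close>, which contains
  \<open>x (Suc n)\<close>.  So \<open>g\<close> moves a point \<open>p\<close> of \<open>x (Suc n)\<close> by at most the mesh of the subdivision
  containing \<open>x n\<close>, and \<open>f p\<close> lies within one more mesh width of \<open>g p\<close>.
\<close>

lemma fixed_point_of_coherent_sequence:
  fixes K :: "'a::euclidean_space set set"
  assumes K: "geometric_complex K" and f: "continuous_on (\<Union>K) f"
    and seq: "finite_approximative_sequence K f X h ff"
    and x: "\<And>n. x (Suc n) \<in> Field (X (Suc n)) \<and> x n = h n (x (Suc n))"
    and fixed: "\<And>n. m \<le> Suc n \<Longrightarrow> x (Suc n) \<in> multi_map X h ff n (x (Suc n))"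
  shows "\<exists>p\<in>\<Union>K. f p = p"
proof -
  interpret geometric_complex K by (rule K)
  obtain \<phi> g k where
    "\<forall>n. simplicial_map (iter_subdivision K (\<phi> n)) (iter_subdivision K n) (g n) \<and>
         simplicially_close (iter_subdivision K (\<phi> n)) (iter_subdivision K n) (g n) f"
    and "\<forall>n. k (Suc n) = \<phi> (k n)" and k_mono: "strict_mono k"
    and "\<forall>n. X n = fin_space K (k n)" and "\<forall>n. h n = natural_map K (k n) (k (Suc n))"
    and "\<forall>n. ff n = image (g (k n))"
    using seq unfolding finite_approximative_sequence_def by (elim exE conjE) (rule that)
  then have close: "simplicially_close (iter_subdivision K (\<phi> n)) (iter_subdivision K n) (g n) f"
    and k: "k (Suc n) = \<phi> (k n)" and X: "X n = fin_space K (k n)"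
    and h: "h n = natural_map K (k n) (k (Suc n))" and ff: "ff n = image (g (k n))" for n
    by auto
  show ?thesis
  proof (rule fixed_point_from_approximate_fixed_points[OF compact_Union f])
    fix e :: real assume "0 < e"
    then obtain N where N: "\<And>n S x y. N \<le> n \<Longrightarrow> S \<in> simplices (iter_subdivision K n) \<Longrightarrow> x \<in> S \<Longrightarrow> y \<in> S \<Longrightarrow> dist x y < e / 2"
      using mesh_iter_tendsto_0[of "e / 2"] by auto
    \<comment> \<open>The successor keeps \<open>k n\<close> positive, away from the reversed order at stage \<open>0\<close>.\<close>
    define n where "n = Suc (max m N)"
    have kn: "n \<le> k n" "k n < k (Suc n)" using strict_mono_imp_increasing[OF k_mono] k_mono by (auto simp: strict_mono_Suc_iff)
    then have pos: "0 < k n" "0 < k (Suc n)" "N \<le> k n" by (auto simp: n_def)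
    have S: "x (Suc n) \<in> simplices (iter_subdivision K (k (Suc n)))"
      using x[of n] pos(2) by (simp add: X fin_space_eq_face_poset Field_face_poset)
    have "h n (x (Suc n)) = x n" using x[of n] by simp
    then have sub: "x (Suc n) \<subseteq> x n" and T: "x n \<in> simplices (iter_subdivision K (k n))"
      using subset_natural_map[OF pos(1) less_imp_le[OF kn(2)] S] h[of n] by auto
    have eq: "x n = g (k n) ` x (Suc n)"
      using fixed[of n] x[of n] by (simp add: multi_map_def ff n_def)
    obtain p where p: "p \<in> x (Suc n)" using S unfolding simplices_def by blast
    have pK: "p \<in> \<Union>(iter_subdivision K (\<phi> (k n)))" using p S k unfolding simplices_def by auto
    then obtain U where U: "U \<in> simplices (iter_subdivision K (k n))" "g (k n) p \<in> U" "f p \<in> U"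
      using close[of "k n"] unfolding simplicially_close_def by blast
    have "dist p (g (k n) p) < e / 2" using N[OF pos(3) T] p sub eq by blast
    moreover have "dist (g (k n) p) (f p) < e / 2" using N[OF pos(3) U] .
    ultimately have "dist p (f p) \<le> e" using dist_triangle[of p "f p" "g (k n) p"] by linarith
    then show "\<exists>p\<in>\<Union>K. dist p (f p) \<le> e" using pK Union_iter by blast
  qed
qed

text \<open>
  The sequence consists of the carriers of \<open>p\<close> in the subdivisions.  The approximations are chosen
  to map each carrier onto the preceding one whenever the numbers of vertices permit it.
\<close>

lemma coherent_sequence_of_fixed_point:
  fixes K :: "'a::euclidean_space set set"
  assumes K: "geometric_complex K" and f: "continuous_on (\<Union>K) f" "f ` (\<Union>K) \<subseteq> \<Union>K"
    and p: "p \<in> \<Union>K" "f p = p"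
  shows "\<exists>X h ff (x :: nat \<Rightarrow> 'a set) (m :: nat).
       finite_approximative_sequence K f X h ff \<and>
       (\<forall>n. x (Suc n) \<in> Field (X (Suc n)) \<and> x n = h n (x (Suc n))) \<and>
       (\<forall>n. Suc n \<ge> m \<longrightarrow> x (Suc n) \<in> multi_map X h ff n (x (Suc n)))"
proof -
  interpret geometric_complex K by (rule K)
  let ?K = "iter_subdivision K"
  let ?\<sigma> = "\<lambda>n. carrier (?K n) p"
  let ?good = "\<lambda>n l g. simplicial_map (?K l) (?K n) g \<and> simplicially_close (?K l) (?K n) g f \<and>
      (card (verts (?\<sigma> n)) \<le> card (verts (?\<sigma> l)) \<longrightarrow> g ` ?\<sigma> l = ?\<sigma> n)"
  have "\<exists>l0. \<forall>l\<ge>l0. \<exists>g. ?good n l g" for n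
  proof -
    interpret M: geometric_complex "?K n" by (rule geometric_complex_iter)
    obtain e where e: "0 < e" "\<And>M. geometric_complex M \<Longrightarrow> \<Union>M = \<Union>(?K n) \<Longrightarrow>
       (\<And>S x y. S \<in> simplices M \<Longrightarrow> x \<in> S \<Longrightarrow> y \<in> S \<Longrightarrow> dist x y < e) \<Longrightarrow>
       \<exists>g. simplicial_map M (?K n) g \<and> simplicially_close M (?K n) g f \<and>
         (card (verts (carrier (?K n) p)) \<le> card (verts (carrier M p)) \<longrightarrow> g ` carrier M p = carrier (?K n) p)"
      by (rule M.ex_simplicial_approximation[of f p]) (use f p in \<open>auto simp only: Union_iter\<close>)
    obtain N where "\<And>l S x y. N \<le> l \<Longrightarrow> S \<in> simplices (?K l) \<Longrightarrow> x \<in> S \<Longrightarrow> y \<in> S \<Longrightarrow> dist x y < e"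
      using mesh_iter_tendsto_0[OF e(1)] by blast
    then have "\<exists>g. ?good n l g" if "N \<le> l" for l
      by (intro e(2) geometric_complex_iter) (use that in \<open>auto simp only: Union_iter\<close>)
    then show ?thesis by blast
  qed
  then obtain l0 where l0: "\<And>n l. l0 n \<le> l \<Longrightarrow> \<exists>g. ?good n l g" by metis
  \<comment> \<open>The sum puts \<open>\<phi> n\<close> above the threshold \<open>l0 n\<close>; with the summand \<open>Suc n\<close> both \<open>\<phi>\<close> and \<open>k\<close> increase strictly.\<close>
  define \<phi> where "\<phi> n = Suc n + (\<Sum>i\<le>n. l0 i)" for n
  have \<phi>_mono: "strict_mono \<phi>" by (simp add: strict_mono_Suc_iff \<phi>_def)
  have "l0 n \<le> \<phi> n" for n unfolding \<phi>_def using member_le_sum[of n "{..n}" l0] by simp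
  then have "\<exists>g. ?good n (\<phi> n) g" for n by (rule l0)
  then obtain g where g: "\<And>n. ?good n (\<phi> n) (g n)" by metis
  define k where "k n = (\<phi> ^^ n) 0" for n
  have k: "k 0 = 0" "\<And>n. k (Suc n) = \<phi> (k n)" by (simp_all add: k_def)
  have k_mono: "strict_mono k" by (simp add: strict_mono_Suc_iff k \<phi>_def)
  have k_ge: "n \<le> k n" for n by (rule strict_mono_imp_increasing[OF k_mono])
  define X where "X n = fin_space K (k n)" for n
  define h where "h n = natural_map K (k n) (k (Suc n))" for n
  define ff where "ff n = image (g (k n))" for n
  \<comment> \<open>At stage \<open>0\<close> the natural map does not send carriers to carriers, so \<open>x 0\<close> is the image of \<open>x 1\<close>.\<close>
  define x where "x n = (if n = 0 then h 0 (?\<sigma> (k 1)) else ?\<sigma> (k n))" for n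
  have seq: "finite_approximative_sequence K f X h ff"
    unfolding finite_approximative_sequence_def
    by (rule exI[of _ \<phi>], rule exI[of _ g], rule exI[of _ k])
      (use g in \<open>auto simp: \<phi>_mono k k_mono X_def h_def ff_def\<close>)
  have pos: "0 < k (Suc n)" for n using k_ge[of "Suc n"] by simp
  have "p \<in> \<Union>(?K n)" for n using p(1) Union_iter by blast
  then have "?\<sigma> n \<in> simplices (?K n)" for n
    using geometric_complex.carrier_in[OF geometric_complex_iter] by blast
  then have in_X: "x (Suc n) \<in> Field (X (Suc n))" for n
    using fin_space_eq_face_poset[OF pos] by (simp add: x_def X_def Field_face_poset)
  have coherent: "x n = h n (x (Suc n))" for n
  proof (cases n)
    case (Suc i)
    then show ?thesis
      using natural_map_carrier[OF _ _ p(1), of "k n" "k (Suc n)"] pos[of i] k_mono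
      by (simp add: x_def h_def strict_mono_less_eq)
  qed (simp add: x_def)
  obtain N where N: "\<And>n l. N \<le> n \<Longrightarrow> n \<le> l \<Longrightarrow> card (verts (?\<sigma> n)) \<le> card (verts (?\<sigma> l))"
    using card_verts_carrier_stabilizes[OF p(1)] by blast
  \<comment> \<open>The bound gives \<open>N \<le> n\<close> and \<open>0 < n\<close>, so that \<open>x n\<close> is a carrier as well.\<close>
  have "x (Suc n) \<in> multi_map X h ff n (x (Suc n))" if "N + 2 \<le> Suc n" for n
  proof -
    have "k n \<le> \<phi> (k n)" "N \<le> k n" using k_ge[of n] that by (auto simp: \<phi>_def)
    then have "g (k n) ` ?\<sigma> (k (Suc n)) = ?\<sigma> (k n)" using g[of "k n"] N k(2) by simp
    then have "ff n (x (Suc n)) = x n" using that by (simp add: ff_def x_def)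
    then show ?thesis using in_X[of n] coherent[of n] by (simp add: multi_map_def)
  qed
  then show ?thesis using seq in_X coherent by blast
qed

theorem theorem5p15:
  fixes K :: "'a::euclidean_space set set" and f :: "'a \<Rightarrow> 'a"
  assumes "simplicial_complex K"
    and "continuous_on (\<Union>K) f"
    and "f ` (\<Union>K) \<subseteq> \<Union>K"
  shows "(\<exists>p\<in>\<Union>K. f p = p) \<longleftrightarrow>
    (\<exists>X h ff (x :: nat \<Rightarrow> 'a set) (m :: nat).
       finite_approximative_sequence K f X h ff \<and>
       (\<forall>n. x (Suc n) \<in> Field (X (Suc n)) \<and> x n = h n (x (Suc n))) \<and>
       (\<forall>n. Suc n \<ge> m \<longrightarrow> x (Suc n) \<in> multi_map X h ff n (x (Suc n))))"
proof -
  have K: "geometric_complex K" using assms(1) by (rule simplicial_complex_imp_geometric_complex)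
  show ?thesis
  proof
    assume "\<exists>p\<in>\<Union>K. f p = p"
    then obtain p where "p \<in> \<Union>K" "f p = p" by blast
    then show "\<exists>X h ff (x :: nat \<Rightarrow> 'a set) (m :: nat).
       finite_approximative_sequence K f X h ff \<and>
       (\<forall>n. x (Suc n) \<in> Field (X (Suc n)) \<and> x n = h n (x (Suc n))) \<and>
       (\<forall>n. Suc n \<ge> m \<longrightarrow> x (Suc n) \<in> multi_map X h ff n (x (Suc n)))"
      by (rule coherent_sequence_of_fixed_point[OF K assms(2,3)])
  next
    assume "\<exists>X h ff (x :: nat \<Rightarrow> 'a set) (m :: nat).
       finite_approximative_sequence K f X h ff \<and>
       (\<forall>n. x (Suc n) \<in> Field (X (Suc n)) \<and> x n = h n (x (Suc n))) \<and>
       (\<forall>n. Suc n \<ge> m \<longrightarrow> x (Suc n) \<in> multi_map X h ff n (x (Suc n)))"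
    then show "\<exists>p\<in>\<Union>K. f p = p"
      using fixed_point_of_coherent_sequence[OF K assms(2)] by blast
  qed
qed

end
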